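(* Let $\varphi(t)=\operatorname{sinc}(t)=\dfrac{\sin(\pi t)}{\pi t}$, i.e. $\varphi$ is the inverse Fourier transform of the characteristic function $\chi_{(-1/2,1/2)}$. For $j\in\mathbb N$ and $\lambda\in\mathbb Z$ put $$\varphi_{j,+,\lambda}=T_{\lambda/2^j}\Big(\frac1{2^{j/2}}\sum_{\eta=2^j}^{2^{j+1}-1}e^{2\pi i\eta t}\varphi(t)\Big),\qquad \varphi_{j,-,\lambda}=T_{\lambda/2^j}\Big(\frac1{2^{j/2}}\sum_{\eta=2^j}^{2^{j+1}-1}e^{-2\pi i\eta t}\varphi(t)\Big),\qquad \varphi_{\bullet,\lambda}(t)=\varphi(t-\lambda).$$ Then the system $\{\varphi_{\bullet,\lambda}:\lambda\in\mathbb Z\}\cup\{\varphi_{j,k,\lambda}:j\in\mathbb N,\ k\in\{+,-\},\ \lambda\in\mathbb Z\}$ is an orthonormal basis of $L^2(\mathbb R)$.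
   Context: $\mathbb N=\{0,1,2,\dots\}$. Fourier transform: $\widehat u(\omega)=\int e^{-2\pi i x\omega}u(x)\,dx$. $T_xf(t)=f(t-x)$. *)

theory Defs
  imports "HOL-Analysis.Analysis"
begin

text \<open>
  Elements of \<open>L\<^sup>2\<close> are represented by functions (not by classes modulo null sets). All notions
  below are invariant under changing representatives almost everywhere.
\<close>

definition L2_space :: "'a measure \<Rightarrow> ('a \<Rightarrow> complex) set" where
  "L2_space M = {f \<in> borel_measurable M. integrable M (\<lambda>x. (cmod (f x))\<^sup>2)}"

definition L2_inner :: "'a measure \<Rightarrow> ('a \<Rightarrow> complex) \<Rightarrow> ('a \<Rightarrow> complex) \<Rightarrow> complex" where
  "L2_inner M f g = (LINT x|M. f x * cnj (g x))"

definition L2_norm :: "'a measure \<Rightarrow> ('a \<Rightarrow> complex) \<Rightarrow> real" where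
  "L2_norm M f = sqrt (LINT x|M. (cmod (f x))\<^sup>2)"

definition L2_orthonormal :: "'a measure \<Rightarrow> ('i \<Rightarrow> 'a \<Rightarrow> complex) \<Rightarrow> bool" where
  "L2_orthonormal M e \<longleftrightarrow>
     (\<forall>i. e i \<in> L2_space M) \<and>
     (\<forall>i j. L2_inner M (e i) (e j) = (if i = j then 1 else 0))"

text \<open>Totality: the finite linear combinations of the family are norm-dense in \<open>L\<^sup>2\<close>.\<close>

definition L2_total :: "'a measure \<Rightarrow> ('i \<Rightarrow> 'a \<Rightarrow> complex) \<Rightarrow> bool" where
  "L2_total M e \<longleftrightarrow>
     (\<forall>f \<in> L2_space M. \<forall>\<epsilon>>0. \<exists>F c. finite F \<and>
        L2_norm M (\<lambda>x. f x - (\<Sum>i\<in>F. c i * e i x)) < \<epsilon>)"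

definition L2_orthonormal_basis :: "'a measure \<Rightarrow> ('i \<Rightarrow> 'a \<Rightarrow> complex) \<Rightarrow> bool" where
  "L2_orthonormal_basis M e \<longleftrightarrow> L2_orthonormal M e \<and> L2_total M e"

definition translate :: "real \<Rightarrow> (real \<Rightarrow> complex) \<Rightarrow> real \<Rightarrow> complex" where
  "translate x f = (\<lambda>t. f (t - x))"

text \<open>Normalised cardinal sine, with the removable singularity at \<open>0\<close> filled in.\<close>

definition phi :: "real \<Rightarrow> complex" where
  "phi t = (if t = 0 then 1 else complex_of_real (sin (pi * t) / (pi * t)))"

lemma phi_inverse_fourier:
  "phi t = (LINT \<omega>|lborel. exp (2 * pi * \<i> * t * \<omega>) * indicator {-1/2<..<1/2::real} \<omega>)"
proof -
  have ae: "AE \<omega> in lborel. exp (2 * pi * \<i> * t * \<omega>) * indicator {-1/2<..<1/2::real} \<omega>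
      = indicator {-1/2..1/2::real} \<omega> *\<^sub>R exp (2 * pi * \<i> * t * \<omega>)"
    using AE_lborel_singleton[of "-1/2::real"] AE_lborel_singleton[of "1/2::real"]
    by eventually_elim (auto simp: indicator_def)
  have "(LINT \<omega>|lborel. exp (2 * pi * \<i> * t * \<omega>) * indicator {-1/2<..<1/2::real} \<omega>)
     = (LINT \<omega>|lborel. indicator {-1/2..1/2::real} \<omega> *\<^sub>R exp (2 * pi * \<i> * t * \<omega>))"
  proof (rule integral_cong_AE[OF _ _ ae])
    have [measurable]: "(\<lambda>\<omega>::real. exp (2 * pi * \<i> * t * \<omega>)) \<in> borel_measurable borel"
      by (intro borel_measurable_continuous_onI continuous_intros)
    show "(\<lambda>\<omega>. exp (2 * pi * \<i> * t * \<omega>) * indicator {-1/2<..<1/2::real} \<omega>) \<in> borel_measurable lborel"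
      by measurable
    show "(\<lambda>\<omega>. indicator {-1/2..1/2::real} \<omega> *\<^sub>R exp (2 * pi * \<i> * t * \<omega>)) \<in> borel_measurable lborel"
      by measurable
  qed
  also have "\<dots> = phi t"
  proof (cases "t = 0")
    case True
    then show ?thesis by (simp add: phi_def scaleR_conv_of_real)
  next
    case False
    define a where "a = 2 * pi * \<i> * t"
    have a: "a \<noteq> 0" using False by (simp add: a_def)
    have "(LINT \<omega>|lborel. indicator {-1/2..1/2::real} \<omega> *\<^sub>R exp (a * \<omega>))
        = exp (a * (1/2::real)) / a - exp (a * (-1/2::real)) / a"
    proof (rule integral_FTC_atLeastAtMost)
      show "((\<lambda>x. exp (a * x) / a) has_vector_derivative exp (a * x))
          (at x within {-1/2..1/2})" for x :: real
      proof -
        have "((\<lambda>z. exp (a * z) / a) has_field_derivative exp (a * of_real x)) (at (of_real x))"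
          using a by (auto intro!: derivative_eq_intros)
        then show ?thesis
          by (rule has_vector_derivative_real_field)
      qed
    qed (auto intro!: continuous_intros)
    also have "\<dots> = (exp (\<i> * (pi * t)) - exp (- (\<i> * (pi * t)))) / (2 * pi * \<i> * t)"
      by (simp add: a_def diff_divide_distrib mult_ac)
    also have "\<dots> = sin (complex_of_real (pi * t)) / (pi * t)"
      by (simp add: sin_exp_eq mult_ac)
    also have "\<dots> = phi t"
      using False by (simp add: phi_def flip: sin_of_real)
    finally show ?thesis by (simp add: a_def)
  qed
  finally show ?thesis by simp
qed

definition phi_plus :: "nat \<Rightarrow> int \<Rightarrow> real \<Rightarrow> complex" where
  "phi_plus j l = translate (of_int l / 2 ^ j)
     (\<lambda>t. of_real (1 / 2 powr (real j / 2)) *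
        (\<Sum>\<eta>::nat = 2 ^ j..2 ^ (j + 1) - 1. exp (2 * of_real pi * \<i> * of_nat \<eta> * of_real t) * phi t))"

definition phi_minus :: "nat \<Rightarrow> int \<Rightarrow> real \<Rightarrow> complex" where
  "phi_minus j l = translate (of_int l / 2 ^ j)
     (\<lambda>t. of_real (1 / 2 powr (real j / 2)) *
        (\<Sum>\<eta>::nat = 2 ^ j..2 ^ (j + 1) - 1. exp (- 2 * of_real pi * \<i> * of_nat \<eta> * of_real t) * phi t))"

datatype wavelet_index = Low int | Plus nat int | Minus nat int

fun wavelet :: "wavelet_index \<Rightarrow> real \<Rightarrow> complex" where
  "wavelet (Low l) = (\<lambda>t. phi (t - of_int l))"
| "wavelet (Plus j l) = phi_plus j l"
| "wavelet (Minus j l) = phi_minus j l"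

end

theory Submission
  imports Defs "HOL-Probability.Sinc_Integral"
begin

text \<open>
  On the Fourier side, the wavelets of one band are the exponentials of period \<open>M\<close>, cut off to an
  interval of length \<open>M\<close> that is a union of the unit intervals centred at \<open>M\<close> consecutive integers
  \<open>\<eta>\<close>, and the bands tile the line. The proof below does not go through Plancherel's theorem: everything
  is read off in the time domain from the sampling identity
  \<open>(\<Sum>l. sinc (t - l) * sinc (s - l)) = sinc (t - s)\<close>, summed over the integers (\<open>nsinc_sampling\<close>),
  which is the partial fraction expansion of the cotangent, itself the logarithmic derivative of
  Euler's reflection formula for the Gamma function.

  Orthonormality. The functions \<open>exp (2 * pi * \<i> * \<eta> * (t - a)) * sinc (t - a)\<close> with integral \<open>\<eta>\<close> (here
  called atoms) are the building blocks of all wavelets. The product of two atoms is periodised: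
  its integral over the line is the integral over one period of the sum of its integer translates.
  The exponential factor has period 1 and the sampling identity evaluates the remaining
  sum to a constant, so atoms of different frequency are orthogonal and atoms of the same frequency
  have inner product \<open>sinc\<close>, up to a phase (\<open>atom_inner\<close>). Bands are disjoint sets of
  frequencies, and within a band the geometric sum over the \<open>M\<close> frequencies contracts to \<open>sinc\<close>
  dilated by \<open>M\<close>, which vanishes at the nonzero integers (\<open>block_wavelet_inner\<close>).

  Totality. The geometric sum also shows that a wavelet is a modulated \<open>sinc\<close> dilated by \<open>M\<close>, so the
  sampling identity computes the reproducing kernel \<open>(\<Sum>l. e l s * cnj (e l t))\<close> of one band, and
  adding the kernels of the first bands gives the kernel \<open>r * sinc (r * (s - t))\<close> with odd \<open>r\<close> tending
  to infinity (\<open>stage_kernel\<close>). For the indicator function \<open>f\<close> of \<open>{a..b}\<close>, the sum of the squared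
  coefficients \<open>\<langle>f, e i\<rangle>\<close> is the double integral of this kernel over \<open>{a..b}\<close>. By Dirichlet's integral
  it tends to \<open>b - a\<close>, the squared norm of \<open>f\<close>. So Bessel's inequality becomes an
  equality for \<open>f\<close>, and \<open>f\<close> lies in the closed span. A Dynkin system argument passes from intervals to
  Borel sets, and simple functions then exhaust the whole space (\<open>L2_total_intervals\<close>).
\<close>

section \<open>The cotangent expansion and the sampling identity\<close>

text \<open>
  Logarithmic differentiation of the reflection formula for the reciprocal Gamma function.
\<close>

lemma Digamma_reflection:
  fixes z :: complex
  assumes z: "z \<notin> \<int>"
  shows "Digamma (1 - z) - Digamma z = of_real pi * cot (of_real pi * z)"
proof -
  have z0: "z \<notin> \<int>\<^sub>\<le>\<^sub>0"
    using z by (meson nonpos_Ints_Int)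
  have "1 - z \<notin> \<int>"
    using z by (metis Ints_1 Ints_diff diff_diff_eq2 add_diff_cancel_left')
  then have z1: "1 - z \<notin> \<int>\<^sub>\<le>\<^sub>0"
    by (meson nonpos_Ints_Int)
  have eq: "(\<lambda>w::complex. rGamma w * rGamma (1 - w)) = (\<lambda>w. sin (of_real pi * w) / of_real pi)"
    by (simp add: rGamma_reflection_complex fun_eq_iff)
  have "((\<lambda>w. rGamma w * rGamma (1 - w)) has_field_derivative
      rGamma z * rGamma (1 - z) * (Digamma (1 - z) - Digamma z)) (at z)"
    using z0 z1 by (auto intro!: derivative_eq_intros simp: algebra_simps)
  moreover have "((\<lambda>w. sin (of_real pi * w) / of_real pi) has_field_derivative
      cos (of_real pi * z)) (at z)"
    by (auto intro!: derivative_eq_intros)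
  ultimately have "rGamma z * rGamma (1 - z) * (Digamma (1 - z) - Digamma z) = cos (of_real pi * z)"
    unfolding eq by (rule DERIV_unique)
  moreover have "sin (of_real pi * z) \<noteq> 0"
    using z by (auto simp: sin_eq_0)
  ultimately show ?thesis
    by (simp add: rGamma_reflection_complex cot_def field_simps)
qed

lemma Polygamma_1_reflection:
  fixes z :: complex
  assumes z: "z \<notin> \<int>"
  shows "Polygamma 1 (1 - z) + Polygamma 1 z = (of_real pi / sin (of_real pi * z))\<^sup>2"
proof -
  have z0: "z \<notin> \<int>\<^sub>\<le>\<^sub>0"
    using z by (meson nonpos_Ints_Int)
  have "1 - z \<notin> \<int>"
    using z by (metis Ints_1 Ints_diff diff_diff_eq2 add_diff_cancel_left')
  then have z1: "1 - z \<notin> \<int>\<^sub>\<le>\<^sub>0"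
    by (meson nonpos_Ints_Int)
  have s: "sin (of_real pi * z) \<noteq> 0"
    using z by (auto simp: sin_eq_0)
  have "((\<lambda>w. Digamma (1 - w) - Digamma w) has_field_derivative
      - Polygamma 1 (1 - z) - Polygamma 1 z) (at z)"
    using z0 z1 by (auto intro!: derivative_eq_intros DERIV_chain2[OF has_field_derivative_Polygamma])
  moreover have "((\<lambda>w. Digamma (1 - w) - Digamma w) has_field_derivative
      - (of_real pi / sin (of_real pi * z))\<^sup>2) (at z)"
  proof (subst DERIV_cong_ev[OF refl _ refl])
    show "\<forall>\<^sub>F w in nhds z. Digamma (1 - w) - Digamma w = of_real pi * cot (of_real pi * w)"
      using eventually_nhds_in_open[of "- \<int>" z] z
      by (auto elim!: eventually_mono simp: Digamma_reflection open_Compl)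
    show "((\<lambda>w. of_real pi * cot (of_real pi * w)) has_field_derivative
        - (of_real pi / sin (of_real pi * z))\<^sup>2) (at z)"
      using s by (auto intro!: derivative_eq_intros DERIV_chain2[OF DERIV_cot]
          simp: power2_eq_square field_simps)
  qed
  ultimately have "- Polygamma 1 (1 - z) - Polygamma 1 z = - (of_real pi / sin (of_real pi * z))\<^sup>2"
    by (rule DERIV_unique)
  then show ?thesis
    by (simp add: algebra_simps minus_equation_iff add_eq_0_iff)
qed

text \<open>
  All sums over the integers are taken along the intervals \<open>{-N..<N}\<close>, so that a sum splits into two sums
  over the natural numbers of the same length. In \<open>sum_reciprocal_products\<close> each of these is a difference
  of two divergent harmonic sums, and the divergent parts cancel.
\<close>

lemma sum_int_symmetric:
  "(\<Sum>l\<in>{-int N..<int N}. g l) = (\<Sum>k<N. g (int k)) + (\<Sum>k<N. g (- int k - 1))"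
proof (induction N)
  case (Suc N)
  have "{- int (Suc N)..<int (Suc N)} = insert (int N) (insert (- int N - 1) {-int N..<int N})"
    by auto
  then show ?case
    using Suc by (simp add: algebra_simps)
qed simp

lemma tendsto_sum_Digamma_diff:
  fixes u v :: complex
  assumes "u \<noteq> 0" "v \<noteq> 0"
  shows "(\<lambda>N. \<Sum>k<N. inverse (u + of_nat k) - inverse (v + of_nat k)) \<longlonglongrightarrow> Digamma v - Digamma u"
proof -
  have "(\<lambda>m. (of_real (ln (real m)) - (\<Sum>n<m. inverse (v + of_nat n))) -
       (of_real (ln (real m)) - (\<Sum>n<m. inverse (u + of_nat n)))) \<longlonglongrightarrow> Digamma v - Digamma u"
    by (intro tendsto_intros Digamma_LIMSEQ assms)
  then show ?thesis
    by (simp add: sum_subtractf)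
qed

text \<open>
  For coinciding points the partial fraction decomposition degenerates; the sum is obtained from the
  derivative of the reflection formula instead.
\<close>

lemma sum_reciprocal_products_diag:
  fixes t :: complex
  assumes t: "t \<notin> \<int>"
  shows "(\<lambda>N. \<Sum>l\<in>{-int N..<int N}. 1 / (t - of_int l)\<^sup>2) \<longlonglongrightarrow> (of_real pi / sin (of_real pi * t))\<^sup>2"
proof -
  have nz: "1 + t \<noteq> 0" "- t \<noteq> 0"
    using t by (auto simp: add_eq_0_iff)
  have t': "- t \<notin> \<int>" using t by simp
  have lim: "(\<lambda>N. \<Sum>k<N. inverse ((z + of_nat k)\<^sup>2)) \<longlonglongrightarrow> Polygamma 1 z" if "z \<noteq> 0" for z :: complex
    using Polygamma_LIMSEQ[OF that, of 1] by (simp add: sums_def power2_eq_square)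
  have sgn: "(of_nat k - t)\<^sup>2 = (t - of_nat k)\<^sup>2" for k
    by (rule power2_commute)
  have "(\<lambda>N. (\<Sum>k<N. inverse ((- t + of_nat k)\<^sup>2)) + (\<Sum>k<N. inverse ((1 + t + of_nat k)\<^sup>2)))
      \<longlonglongrightarrow> Polygamma 1 (- t) + Polygamma 1 (1 + t)"
    using nz by (intro tendsto_add lim)
  moreover have "Polygamma 1 (- t) + Polygamma 1 (1 + t) = (of_real pi / sin (of_real pi * t))\<^sup>2"
    using Polygamma_1_reflection[OF t'] by (simp add: power_divide add_ac)
  moreover have "(\<Sum>l\<in>{-int N..<int N}. 1 / (t - of_int l)\<^sup>2) =
      (\<Sum>k<N. inverse ((- t + of_nat k)\<^sup>2)) + (\<Sum>k<N. inverse ((1 + t + of_nat k)\<^sup>2))" for N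
    unfolding sum_int_symmetric
    by (intro arg_cong2[of _ _ _ _ "(+)"] sum.cong) (simp_all add: sgn inverse_eq_divide algebra_simps)
  ultimately show ?thesis by simp
qed

lemma sum_reciprocal_products:
  fixes s t :: complex
  assumes s: "s \<notin> \<int>" and t: "t \<notin> \<int>" and "s \<noteq> t"
  shows "(\<lambda>N. \<Sum>l\<in>{-int N..<int N}. 1 / ((t - of_int l) * (s - of_int l))) \<longlonglongrightarrow>
    of_real pi * (cot (of_real pi * t) - cot (of_real pi * s)) / (s - t)"
proof -
  have nz: "1 + t \<noteq> 0" "- t \<noteq> 0" "1 + s \<noteq> 0" "- s \<noteq> 0"
    using s t by (auto simp: add_eq_0_iff)
  have ns: "s - of_int l \<noteq> 0" "t - of_int l \<noteq> 0" for l
    using s t by auto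
  define D where "D l = 1 / (t - of_int l) - 1 / (s - of_int l)" for l
  have D: "1 / ((t - of_int l) * (s - of_int l)) = D l / (s - t)" for l
    using ns \<open>s \<noteq> t\<close> by (simp add: D_def divide_simps)
  have D1: "D (int k) = inverse (- s + of_nat k) - inverse (- t + of_nat k)" for k
  proof -
    have "inverse (- x + of_nat k) = - (1 / (x - of_nat k))" for x :: complex
      by (metis inverse_eq_divide inverse_minus_eq minus_diff_eq uminus_add_conv_diff)
    then show ?thesis
      by (simp add: D_def)
  qed
  have D2: "D (- int k - 1) = inverse (1 + t + of_nat k) - inverse (1 + s + of_nat k)" for k
    by (simp add: D_def inverse_eq_divide algebra_simps)
  have "(\<lambda>N. \<Sum>l\<in>{-int N..<int N}. D l) \<longlonglongrightarrow>
      (Digamma (- t) - Digamma (- s)) + (Digamma (1 + s) - Digamma (1 + t))"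
    unfolding sum_int_symmetric D1 D2 using nz by (intro tendsto_add tendsto_sum_Digamma_diff)
  moreover have "(Digamma (- t) - Digamma (- s)) + (Digamma (1 + s) - Digamma (1 + t)) =
      of_real pi * (cot (of_real pi * t) - cot (of_real pi * s))"
    using Digamma_reflection[of "- t"] Digamma_reflection[of "- s"] s t by (simp add: algebra_simps)
  ultimately have "(\<lambda>N. (\<Sum>l\<in>{-int N..<int N}. D l) / (s - t)) \<longlonglongrightarrow>
      of_real pi * (cot (of_real pi * t) - cot (of_real pi * s)) / (s - t)"
    using \<open>s \<noteq> t\<close> by (intro tendsto_divide) auto
  then show ?thesis
    by (simp add: D sum_divide_distrib)
qed

definition nsinc :: "real \<Rightarrow> real" where
  "nsinc x = sinc (pi * x)"

lemma nsinc_0 [simp]: "nsinc 0 = 1"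
  by (simp add: nsinc_def)

lemma nsinc_minus [simp]: "nsinc (- x) = nsinc x"
  by (simp add: nsinc_def)

lemma nsinc_commute: "nsinc (x - y) = nsinc (y - x)"
  by (metis minus_diff_eq nsinc_minus)

lemma nsinc_of_int: "nsinc (of_int n) = (if n = 0 then 1 else 0)"
  using sin_npi_int[of n] by (simp add: nsinc_def mult.commute)

lemma pi_mult_nsinc: "pi * x * nsinc x = sin (pi * x)"
  by (simp add: nsinc_def)

lemma continuous_on_nsinc [continuous_intros]:
  "continuous_on A f \<Longrightarrow> continuous_on A (\<lambda>x. nsinc (f x))"
  unfolding nsinc_def
  by (rule continuous_on_compose2[OF continuous_on_sinc[OF continuous_on_id, of UNIV], of A "\<lambda>x. pi * f x"])
    (auto intro!: continuous_intros)

lemma borel_measurable_nsinc [measurable]: "nsinc \<in> borel_measurable borel"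
  by (intro borel_measurable_continuous_onI continuous_intros)

lemma phi_eq_nsinc: "phi t = of_real (nsinc t)"
  by (simp add: phi_def nsinc_def)

lemma nsinc_diff_int_product:
  assumes s: "s \<notin> \<int>" and t: "t \<notin> \<int>"
  shows "nsinc (t - of_int l) * nsinc (s - of_int l) =
    sin (pi * t) * sin (pi * s) / pi\<^sup>2 * (1 / ((t - of_int l) * (s - of_int l)))"
proof -
  have nz: "t - of_int l \<noteq> 0" "s - of_int l \<noteq> 0"
    using s t by auto
  have c: "cos (pi * of_int l) * cos (pi * of_int l) = 1"
    using sin_cos_squared_add3[of "pi * of_int l"] sin_npi_int[of l] by (simp add: mult.commute)
  have sin: "sin (pi * (x - of_int l)) = sin (pi * x) * cos (pi * of_int l)" for x
    using sin_npi_int[of l] by (simp add: right_diff_distrib sin_diff mult.commute)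
  have "nsinc (t - of_int l) * nsinc (s - of_int l) =
      (sin (pi * t) * cos (pi * of_int l)) * (sin (pi * s) * cos (pi * of_int l)) /
      (pi\<^sup>2 * ((t - of_int l) * (s - of_int l)))"
    using nz by (simp add: nsinc_def sin power2_eq_square mult_ac)
  also have "\<dots> = sin (pi * t) * sin (pi * s) * (cos (pi * of_int l) * cos (pi * of_int l)) /
      (pi\<^sup>2 * ((t - of_int l) * (s - of_int l)))"
    by (simp add: mult_ac)
  finally show ?thesis
    by (simp only: c) simp
qed

lemma sum_reciprocal_products_real:
  fixes s t :: real
  assumes s: "s \<notin> \<int>" and t: "t \<notin> \<int>"
  shows "(\<lambda>N. \<Sum>l\<in>{-int N..<int N}. 1 / ((t - of_int l) * (s - of_int l))) \<longlonglongrightarrow>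
    pi\<^sup>2 * nsinc (t - s) / (sin (pi * t) * sin (pi * s))"
proof -
  have s': "complex_of_real s \<notin> \<int>" and t': "complex_of_real t \<notin> \<int>"
    using s t by (simp_all add: of_real_in_Ints_iff)
  have nz: "sin (pi * s) \<noteq> 0" "sin (pi * t) \<noteq> 0"
    using s t by (auto simp: sin_zero_iff_int2 Ints_def)
  have "(\<lambda>N. \<Sum>l\<in>{-int N..<int N}. 1 / ((complex_of_real t - of_int l) * (complex_of_real s - of_int l))) \<longlonglongrightarrow>
    complex_of_real (pi\<^sup>2 * nsinc (t - s) / (sin (pi * t) * sin (pi * s)))"
  proof (cases "s = t")
    case True
    then show ?thesis
      using sum_reciprocal_products_diag[OF t']
      by (simp add: power2_eq_square flip: sin_of_real)
  next
    case False
    have "pi * (cot (pi * t) - cot (pi * s)) / (s - t) = 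
        pi * (sin (pi * (s - t)) / (sin (pi * t) * sin (pi * s))) / (s - t)"
      using nz by (simp add: cot_def right_diff_distrib sin_diff field_simps)
    also have "\<dots> = pi\<^sup>2 * nsinc (t - s) / (sin (pi * t) * sin (pi * s))"
      using False nz nsinc_commute[of t s] by (simp add: nsinc_def power2_eq_square)
    finally have eq: "pi * (cot (pi * t) - cot (pi * s)) / (s - t) =
      pi\<^sup>2 * nsinc (t - s) / (sin (pi * t) * sin (pi * s))" .
    show ?thesis
      using sum_reciprocal_products[OF s' t'] False
      unfolding eq[symmetric] by (simp add: cot_of_real)
  qed
  also have "(\<lambda>N. \<Sum>l\<in>{-int N..<int N}. 1 / ((complex_of_real t - of_int l) * (complex_of_real s - of_int l))) =
      (\<lambda>N. of_real (\<Sum>l\<in>{-int N..<int N}. 1 / ((t - of_int l) * (s - of_int l))))"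
    by simp
  finally show ?thesis
    by (simp only: tendsto_of_real_iff)
qed

text \<open>
  For nonintegral points the numerators \<open>sin (pi * (t - l)) * sin (pi * (s - l))\<close> do not depend on \<open>l\<close>, and
  what remains is the cotangent expansion. If one of the points is an integer, only one summand
  is nonzero.
\<close>

theorem nsinc_sampling:
  "(\<lambda>N. \<Sum>l\<in>{-int N..<int N}. nsinc (t - of_int l) * nsinc (s - of_int l)) \<longlonglongrightarrow> nsinc (t - s)"
proof -
  have int: "(\<lambda>N. \<Sum>l\<in>{-int N..<int N}. nsinc (u - of_int l) * nsinc (of_int m - of_int l)) \<longlonglongrightarrow>
      nsinc (u - of_int m)" for u m
  proof (rule tendsto_eventually, rule eventually_mono[OF eventually_gt_at_top[of "nat \<bar>m\<bar>"]])
    fix N assume "nat \<bar>m\<bar> < N"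
    then have m: "m \<in> {-int N..<int N}" by auto
    have "(\<Sum>l\<in>{-int N..<int N}. nsinc (u - of_int l) * nsinc (of_int m - of_int l)) =
        (\<Sum>l\<in>{-int N..<int N}. if l = m then nsinc (u - of_int m) else 0)"
      using nsinc_of_int[of "m - _"] by (intro sum.cong) auto
    then show "(\<Sum>l\<in>{-int N..<int N}. nsinc (u - of_int l) * nsinc (of_int m - of_int l)) =
        nsinc (u - of_int m)"
      using m by simp
  qed
  consider m where "s = of_int m" | m where "t = of_int m" | "s \<notin> \<int>" "t \<notin> \<int>"
    by (auto simp: Ints_def)
  then show ?thesis
  proof cases
    case (1 m) then show ?thesis using int[of t m] by simp
  next
    case (2 m) then show ?thesis
      using int[of s m] nsinc_commute[of s t] by (simp add: mult.commute)
  next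
    case 3
    have nz: "sin (pi * s) \<noteq> 0" "sin (pi * t) \<noteq> 0"
      using 3 by (auto simp: sin_zero_iff_int2 Ints_def)
    have "(\<lambda>N. sin (pi * t) * sin (pi * s) / pi\<^sup>2 *
          (\<Sum>l\<in>{-int N..<int N}. 1 / ((t - of_int l) * (s - of_int l)))) \<longlonglongrightarrow>
        sin (pi * t) * sin (pi * s) / pi\<^sup>2 * (pi\<^sup>2 * nsinc (t - s) / (sin (pi * t) * sin (pi * s)))"
      by (intro tendsto_mult tendsto_const sum_reciprocal_products_real 3)
    then show ?thesis
      using nz by (simp add: nsinc_diff_int_product[OF 3] sum_distrib_left)
  qed
qed

lemma sum_nsinc_squares_le: "(\<Sum>l\<in>{-int N..<int N}. (nsinc (t - of_int l))\<^sup>2) \<le> 1"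
proof -
  have "incseq (\<lambda>N. \<Sum>l\<in>{-int N..<int N}. (nsinc (t - of_int l))\<^sup>2)"
    by (intro incseq_SucI sum_mono2) auto
  moreover have "(\<lambda>N. \<Sum>l\<in>{-int N..<int N}. (nsinc (t - of_int l))\<^sup>2) \<longlonglongrightarrow> 1"
    using nsinc_sampling[of t t] by (simp add: power2_eq_square)
  ultimately show ?thesis
    by (rule incseq_le)
qed

text \<open>
  By the inequality of arithmetic and geometric means the diagonal case bounds all others. The uniformity in
  the two points justifies the exchanges of limit and integral for periodisations and kernels.
\<close>

lemma sum_abs_nsinc_products_le:
  "(\<Sum>l\<in>{-int N..<int N}. \<bar>nsinc (t - of_int l) * nsinc (s - of_int l)\<bar>) \<le> 1"
proof -
  have "\<bar>x * y\<bar> \<le> (x\<^sup>2 + y\<^sup>2) / 2" for x y :: real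
    using sum_squares_bound[of "\<bar>x\<bar>" "\<bar>y\<bar>"] by (simp add: abs_mult)
  then have "(\<Sum>l\<in>{-int N..<int N}. \<bar>nsinc (t - of_int l) * nsinc (s - of_int l)\<bar>) \<le>
      (\<Sum>l\<in>{-int N..<int N}. ((nsinc (t - of_int l))\<^sup>2 + (nsinc (s - of_int l))\<^sup>2) / 2)"
    by (intro sum_mono)
  also have "\<dots> \<le> 1"
    using sum_nsinc_squares_le[of t N] sum_nsinc_squares_le[of s N]
    by (simp add: sum.distrib flip: sum_divide_distrib)
  finally show ?thesis .
qed

section \<open>Square-integrable functions and Bessel's identity\<close>

lemma cmod_add_squared_le: "(cmod (a + b))\<^sup>2 \<le> 2 * (cmod a)\<^sup>2 + 2 * (cmod b)\<^sup>2"
proof -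
  have "(cmod (a + b))\<^sup>2 \<le> (cmod a + cmod b)\<^sup>2"
    by (intro power_mono norm_triangle_ineq) auto
  then show ?thesis
    using sum_squares_bound[of "cmod a" "cmod b"] by (simp add: power2_sum)
qed

lemma L2_space_measurable: "f \<in> L2_space M \<Longrightarrow> f \<in> borel_measurable M"
  by (simp add: L2_space_def)

lemma L2_space_integrable: "f \<in> L2_space M \<Longrightarrow> integrable M (\<lambda>x. (cmod (f x))\<^sup>2)"
  by (simp add: L2_space_def)

lemma L2_space_dominated:
  assumes "f \<in> borel_measurable M" "integrable M h" "\<And>x. x \<in> space M \<Longrightarrow> (cmod (f x))\<^sup>2 \<le> h x"
  shows "f \<in> L2_space M"
proof -
  have "integrable M (\<lambda>x. (cmod (f x))\<^sup>2)"
  proof (rule Bochner_Integration.integrable_bound[OF assms(2)])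
    show "AE x in M. norm ((cmod (f x))\<^sup>2) \<le> norm (h x)"
    proof (rule AE_I2)
      fix x assume "x \<in> space M"
      then show "norm ((cmod (f x))\<^sup>2) \<le> norm (h x)"
        using assms(3)[of x] by simp
    qed
  qed (use assms(1) in measurable)
  then show ?thesis
    using assms(1) by (simp add: L2_space_def)
qed

lemma L2_space_add:
  assumes "f \<in> L2_space M" "g \<in> L2_space M"
  shows "(\<lambda>x. f x + g x) \<in> L2_space M"
proof (rule L2_space_dominated)
  show "(\<lambda>x. f x + g x) \<in> borel_measurable M"
    using assms[THEN L2_space_measurable] by measurable
  show "integrable M (\<lambda>x. 2 * (cmod (f x))\<^sup>2 + 2 * (cmod (g x))\<^sup>2)"
    using assms by (simp add: L2_space_integrable)
qed (rule cmod_add_squared_le)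

lemma L2_space_scale:
  assumes "f \<in> L2_space M"
  shows "(\<lambda>x. c * f x) \<in> L2_space M"
  using assms by (auto simp: L2_space_def norm_mult power_mult_distrib)

lemma L2_space_diff:
  assumes "f \<in> L2_space M" "g \<in> L2_space M"
  shows "(\<lambda>x. f x - g x) \<in> L2_space M"
  using L2_space_add[OF assms(1) L2_space_scale[OF assms(2), of "-1"]] by simp

lemma L2_space_sum:
  assumes "\<And>i. i \<in> F \<Longrightarrow> f i \<in> L2_space M"
  shows "(\<lambda>x. \<Sum>i\<in>F. f i x) \<in> L2_space M"
proof (cases "finite F")
  case True
  then show ?thesis
    using assms
  proof (induction F rule: finite_induct)
    case empty
    show ?case by (simp add: L2_space_def)
  next
    case (insert i F)
    have "(\<lambda>x. f i x + (\<Sum>i\<in>F. f i x)) \<in> L2_space M"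
      by (intro L2_space_add insert.IH insert.prems) auto
    then show ?case
      unfolding sum.insert[OF insert.hyps] .
  qed
qed (simp add: L2_space_def)

lemma borel_measurable_cnj [measurable]: "cnj \<in> borel_measurable borel"
  by (intro borel_measurable_continuous_onI continuous_intros)

lemma L2_product_integrable:
  assumes f: "f \<in> L2_space M" and g: "g \<in> L2_space M"
  shows "integrable M (\<lambda>x. f x * cnj (g x))"
proof (rule Bochner_Integration.integrable_bound)
  show "integrable M (\<lambda>x. (cmod (f x))\<^sup>2 + (cmod (g x))\<^sup>2)"
    using f g by (simp add: L2_space_integrable)
  show "(\<lambda>x. f x * cnj (g x)) \<in> borel_measurable M"
    using f[THEN L2_space_measurable] g[THEN L2_space_measurable] by measurable
  have "cmod (f x * cnj (g x)) \<le> (cmod (f x))\<^sup>2 + (cmod (g x))\<^sup>2" for x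
  proof -
    have "0 \<le> cmod (f x) * cmod (g x)" by simp
    then show ?thesis
      using sum_squares_bound[of "cmod (f x)" "cmod (g x)"] unfolding norm_mult complex_mod_cnj by linarith
  qed
  then show "AE x in M. norm (f x * cnj (g x)) \<le> norm ((cmod (f x))\<^sup>2 + (cmod (g x))\<^sup>2)"
    by (auto intro: order_trans[OF _ abs_ge_self])
qed

lemma Bessel_identity:
  assumes e: "L2_orthonormal M e" and f: "f \<in> L2_space M" and F: "finite F"
  shows "(LINT x|M. (cmod (f x - (\<Sum>i\<in>F. L2_inner M f (e i) * e i x)))\<^sup>2) =
    (LINT x|M. (cmod (f x))\<^sup>2) - (\<Sum>i\<in>F. (cmod (L2_inner M f (e i)))\<^sup>2)"
proof -
  define c where "c i = L2_inner M f (e i)" for i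
  have eL: "e i \<in> L2_space M" for i
    using e by (simp add: L2_orthonormal_def)
  have ee: "(LINT x|M. e i x * cnj (e j x)) = (if i = j then 1 else 0)" for i j
    using e by (simp add: L2_orthonormal_def L2_inner_def)
  have fe: "(LINT x|M. f x * cnj (e i x)) = c i" for i
    by (simp add: c_def L2_inner_def)
  have ef: "(LINT x|M. e i x * cnj (f x)) = cnj (c i)" for i
    unfolding fe[symmetric] by (subst Bochner_Integration.integral_cnj[symmetric]) (simp add: mult.commute)
  note int = L2_product_integrable[OF f f] L2_product_integrable[OF f eL]
    L2_product_integrable[OF eL f] L2_product_integrable[OF eL eL]
  have exp: "of_real ((cmod (f x - (\<Sum>i\<in>F. c i * e i x)))\<^sup>2) =
      f x * cnj (f x) - (\<Sum>i\<in>F. cnj (c i) * (f x * cnj (e i x))) - (\<Sum>i\<in>F. c i * (e i x * cnj (f x)))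
      + (\<Sum>i\<in>F. \<Sum>j\<in>F. c i * cnj (c j) * (e i x * cnj (e j x)))" for x
  proof -
    define S where "S = (\<Sum>i\<in>F. c i * e i x)"
    have "f x * cnj S = (\<Sum>i\<in>F. cnj (c i) * (f x * cnj (e i x)))"
      "S * cnj (f x) = (\<Sum>i\<in>F. c i * (e i x * cnj (f x)))"
      "S * cnj S = (\<Sum>i\<in>F. \<Sum>j\<in>F. c i * cnj (c j) * (e i x * cnj (e j x)))"
      unfolding S_def cnj_sum sum_product by (simp_all add: sum_distrib_left sum_distrib_right mult_ac)
    then show ?thesis
      unfolding complex_norm_square S_def[symmetric] by (simp add: algebra_simps)
  qed
  have "complex_of_real (LINT x|M. (cmod (f x - (\<Sum>i\<in>F. c i * e i x)))\<^sup>2) =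
      (LINT x|M. f x * cnj (f x) - (\<Sum>i\<in>F. cnj (c i) * (f x * cnj (e i x))) - (\<Sum>i\<in>F. c i * (e i x * cnj (f x)))
      + (\<Sum>i\<in>F. \<Sum>j\<in>F. c i * cnj (c j) * (e i x * cnj (e j x))))"
    unfolding exp[symmetric] integral_complex_of_real ..
  also have "\<dots> = (LINT x|M. f x * cnj (f x)) - (\<Sum>i\<in>F. cnj (c i) * c i) - (\<Sum>i\<in>F. c i * cnj (c i))
      + (\<Sum>i\<in>F. \<Sum>j\<in>F. c i * cnj (c j) * (if i = j then 1 else 0))"
    using int by (simp add: fe ef ee)
  also have "(\<Sum>i\<in>F. \<Sum>j\<in>F. c i * cnj (c j) * (if i = j then 1 else 0)) = (\<Sum>i\<in>F. c i * cnj (c i))"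
    using F by (simp add: if_distrib[of "\<lambda>x. _ * x"] cong: if_cong)
  also have "(LINT x|M. f x * cnj (f x)) = of_real (LINT x|M. (cmod (f x))\<^sup>2)"
    unfolding integral_complex_of_real[symmetric] complex_norm_square ..
  finally have "complex_of_real (LINT x|M. (cmod (f x - (\<Sum>i\<in>F. c i * e i x)))\<^sup>2) =
      of_real (LINT x|M. (cmod (f x))\<^sup>2) - (\<Sum>i\<in>F. cnj (c i) * c i)"
    by (simp only: diff_add_cancel)
  also have "(\<Sum>i\<in>F. cnj (c i) * c i) = of_real (\<Sum>i\<in>F. (cmod (c i))\<^sup>2)"
    unfolding of_real_sum complex_norm_square by (intro sum.cong refl mult.commute)
  finally have "complex_of_real (LINT x|M. (cmod (f x - (\<Sum>i\<in>F. c i * e i x)))\<^sup>2) =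
      of_real ((LINT x|M. (cmod (f x))\<^sup>2) - (\<Sum>i\<in>F. (cmod (c i))\<^sup>2))"
    by (simp only: of_real_diff)
  then show ?thesis
    unfolding of_real_eq_iff c_def .
qed

lemma L2_integral_add_le:
  assumes "f \<in> L2_space M" "g \<in> L2_space M" 
  shows "(LINT x|M. (cmod (f x + g x))\<^sup>2) \<le> 2 * (LINT x|M. (cmod (f x))\<^sup>2) + 2 * (LINT x|M. (cmod (g x))\<^sup>2)"
proof -
  have "(LINT x|M. (cmod (f x + g x))\<^sup>2) \<le> (LINT x|M. 2 * (cmod (f x))\<^sup>2 + 2 * (cmod (g x))\<^sup>2)"
  proof (rule integral_mono)
    show "integrable M (\<lambda>x. (cmod (f x + g x))\<^sup>2)"
      by (rule L2_space_integrable[OF L2_space_add[OF assms]])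
    show "integrable M (\<lambda>x. 2 * (cmod (f x))\<^sup>2 + 2 * (cmod (g x))\<^sup>2)"
      using assms[THEN L2_space_integrable] by simp
  qed (rule cmod_add_squared_le)
  then show ?thesis
    using assms[THEN L2_space_integrable] by simp
qed

text \<open>
  Membership in the closed linear span of the family. The error is measured by the square of the norm, so that
  the crude bound \<open>cmod_add_squared_le\<close> replaces the triangle inequality.
\<close>

definition L2_approximable :: "'a measure \<Rightarrow> ('i \<Rightarrow> 'a \<Rightarrow> complex) \<Rightarrow> ('a \<Rightarrow> complex) \<Rightarrow> bool" where
  "L2_approximable M e f \<longleftrightarrow> f \<in> L2_space M \<and>
     (\<forall>\<epsilon>>0. \<exists>F c. finite F \<and> (LINT x|M. (cmod (f x - (\<Sum>i\<in>F. c i * e i x)))\<^sup>2) < \<epsilon>)"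

lemma L2_approximable_imp_norm:
  assumes "L2_approximable M e f" "\<epsilon> > 0"
  shows "\<exists>F c. finite F \<and> L2_norm M (\<lambda>x. f x - (\<Sum>i\<in>F. c i * e i x)) < \<epsilon>"
proof -
  have "\<epsilon>\<^sup>2 > 0" using assms by simp
  then obtain F c where "finite F" "(LINT x|M. (cmod (f x - (\<Sum>i\<in>F. c i * e i x)))\<^sup>2) < \<epsilon>\<^sup>2"
    using assms(1) unfolding L2_approximable_def by blast
  then show ?thesis
    unfolding L2_norm_def using real_less_lsqrt[OF less_imp_le[OF assms(2)]] by blast
qed

context
  fixes M :: "'a measure" and e :: "'i \<Rightarrow> 'a \<Rightarrow> complex"
  assumes eL: "\<And>i. e i \<in> L2_space M"
begin

lemma L2_approximable_closure:
  assumes f: "f \<in> L2_space M"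
    and close: "\<And>\<epsilon>. \<epsilon> > 0 \<Longrightarrow> \<exists>g. L2_approximable M e g \<and> (LINT x|M. (cmod (f x - g x))\<^sup>2) < \<epsilon>"
  shows "L2_approximable M e f"
  unfolding L2_approximable_def
proof (intro conjI allI impI f)
  fix \<epsilon> :: real assume "\<epsilon> > 0"
  then have "\<epsilon> / 4 > 0" by simp
  then obtain g where g: "L2_approximable M e g" "(LINT x|M. (cmod (f x - g x))\<^sup>2) < \<epsilon> / 4"
    using close by blast
  then obtain F c where F: "finite F" "(LINT x|M. (cmod (g x - (\<Sum>i\<in>F. c i * e i x)))\<^sup>2) < \<epsilon> / 4"
    using \<open>\<epsilon> / 4 > 0\<close> unfolding L2_approximable_def by blast
  have gL: "g \<in> L2_space M" using g by (simp add: L2_approximable_def)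
  have "(LINT x|M. (cmod ((f x - g x) + (g x - (\<Sum>i\<in>F. c i * e i x))))\<^sup>2) \<le>
      2 * (LINT x|M. (cmod (f x - g x))\<^sup>2) + 2 * (LINT x|M. (cmod (g x - (\<Sum>i\<in>F. c i * e i x)))\<^sup>2)"
    by (intro L2_integral_add_le L2_space_diff L2_space_sum L2_space_scale f gL eL)
  then show "\<exists>F c. finite F \<and> (LINT x|M. (cmod (f x - (\<Sum>i\<in>F. c i * e i x)))\<^sup>2) < \<epsilon>"
    using g F by (intro exI[of _ F] exI[of _ c]) auto
qed

lemma L2_approximable_add:
  assumes f: "L2_approximable M e f" and g: "L2_approximable M e g"
  shows "L2_approximable M e (\<lambda>x. f x + g x)"
  unfolding L2_approximable_def
proof (intro conjI allI impI)
  have fg: "f \<in> L2_space M" "g \<in> L2_space M"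
    using f g by (auto simp: L2_approximable_def)
  then show "(\<lambda>x. f x + g x) \<in> L2_space M"
    by (rule L2_space_add)
  fix \<epsilon> :: real assume "\<epsilon> > 0"
  then have e4: "\<epsilon> / 4 > 0" by simp
  obtain F c where F: "finite F" "(LINT x|M. (cmod (f x - (\<Sum>i\<in>F. c i * e i x)))\<^sup>2) < \<epsilon> / 4"
    using f e4 unfolding L2_approximable_def by blast
  obtain G d where G: "finite G" "(LINT x|M. (cmod (g x - (\<Sum>i\<in>G. d i * e i x)))\<^sup>2) < \<epsilon> / 4"
    using g e4 unfolding L2_approximable_def by blast
  define k where "k i = (if i \<in> F then c i else 0) + (if i \<in> G then d i else 0)" for i
  have k: "(\<Sum>i\<in>F \<union> G. k i * e i x) = (\<Sum>i\<in>F. c i * e i x) + (\<Sum>i\<in>G. d i * e i x)" for x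
  proof -
    have "(\<Sum>i\<in>F. c i * e i x) = (\<Sum>i\<in>F \<union> G. if i \<in> F then c i * e i x else 0)"
      using F G by (simp add: sum.inter_restrict[symmetric] Int_absorb1)
    moreover have "(\<Sum>i\<in>G. d i * e i x) = (\<Sum>i\<in>F \<union> G. if i \<in> G then d i * e i x else 0)"
      using F G by (simp add: sum.inter_restrict[symmetric] Int_absorb1)
    moreover have "(\<Sum>i\<in>F \<union> G. k i * e i x) = (\<Sum>i\<in>F \<union> G. (if i \<in> F then c i * e i x else 0) +
        (if i \<in> G then d i * e i x else 0))"
      by (intro sum.cong refl) (simp add: k_def distrib_right)
    ultimately show ?thesis
      by (simp only: sum.distrib)
  qed
  have "(LINT x|M. (cmod ((f x - (\<Sum>i\<in>F. c i * e i x)) + (g x - (\<Sum>i\<in>G. d i * e i x))))\<^sup>2) \<le>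
     2 * (LINT x|M. (cmod (f x - (\<Sum>i\<in>F. c i * e i x)))\<^sup>2) +
     2 * (LINT x|M. (cmod (g x - (\<Sum>i\<in>G. d i * e i x)))\<^sup>2)"
    by (intro L2_integral_add_le L2_space_diff L2_space_sum L2_space_scale fg eL)
  then have "(LINT x|M. (cmod (f x + g x - (\<Sum>i\<in>F \<union> G. k i * e i x)))\<^sup>2) < \<epsilon>"
    using F(2) G(2) unfolding k by (simp add: algebra_simps)
  then show "\<exists>F c. finite F \<and> (LINT x|M. (cmod (f x + g x - (\<Sum>i\<in>F. c i * e i x)))\<^sup>2) < \<epsilon>"
    using F(1) G(1) by blast
qed

lemma L2_approximable_scale:
  assumes f: "L2_approximable M e f"
  shows "L2_approximable M e (\<lambda>x. a * f x)"
  unfolding L2_approximable_def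
proof (intro conjI allI impI)
  show "(\<lambda>x. a * f x) \<in> L2_space M"
    using f by (auto simp: L2_approximable_def intro: L2_space_scale)
  fix \<epsilon> :: real assume "\<epsilon> > 0"
  then have "\<epsilon> / ((cmod a)\<^sup>2 + 1) > 0"
    by (simp add: add_nonneg_pos)
  then obtain F c where F: "finite F"
      "(LINT x|M. (cmod (f x - (\<Sum>i\<in>F. c i * e i x)))\<^sup>2) < \<epsilon> / ((cmod a)\<^sup>2 + 1)" (is "?I < _")
    using f unfolding L2_approximable_def by blast
  have "a * f x - (\<Sum>i\<in>F. (a * c i) * e i x) = a * (f x - (\<Sum>i\<in>F. c i * e i x))" for x
    by (simp add: algebra_simps sum_distrib_left)
  then have "(LINT x|M. (cmod (a * f x - (\<Sum>i\<in>F. (a * c i) * e i x)))\<^sup>2) = (cmod a)\<^sup>2 * ?I"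
    by (simp add: norm_mult power_mult_distrib)
  also have "\<dots> \<le> ((cmod a)\<^sup>2 + 1) * ?I"
    by (intro mult_right_mono) auto
  also have "\<dots> < \<epsilon>"
    using F(2) by (simp add: pos_less_divide_eq add_nonneg_pos mult.commute)
  finally show "\<exists>F c. finite F \<and> (LINT x|M. (cmod (a * f x - (\<Sum>i\<in>F. c i * e i x)))\<^sup>2) < \<epsilon>"
    using F(1) by (intro exI[of _ F] exI[of _ "\<lambda>i. a * c i"]) auto
qed

lemma L2_approximable_zero: "L2_approximable M e (\<lambda>x. 0)"
  unfolding L2_approximable_def by (auto simp: L2_space_def intro!: exI[of _ "{}"])

lemma L2_approximable_indicator_empty: "L2_approximable M e (indicator {})"
proof -
  have "(indicator {} :: 'a \<Rightarrow> complex) = (\<lambda>x. 0)"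
    by (rule ext) simp
  then show ?thesis
    by (simp only: L2_approximable_zero)
qed

lemma L2_approximable_diff:
  assumes "L2_approximable M e f" "L2_approximable M e g"
  shows "L2_approximable M e (\<lambda>x. f x - g x)"
  using L2_approximable_add[OF assms(1) L2_approximable_scale[OF assms(2), of "-1"]] by simp

lemma L2_approximable_sum:
  assumes "\<And>i. i \<in> F \<Longrightarrow> L2_approximable M e (f i)"
  shows "L2_approximable M e (\<lambda>x. \<Sum>i\<in>F. f i x)"
proof (cases "finite F")
  case True
  then show ?thesis
    using assms
  proof (induction F rule: finite_induct)
    case empty
    show ?case by (simp add: L2_approximable_zero)
  next
    case (insert i F)
    have "L2_approximable M e (\<lambda>x. f i x + (\<Sum>i\<in>F. f i x))"
      by (intro L2_approximable_add insert.IH insert.prems) auto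
    then show ?case
      unfolding sum.insert[OF insert.hyps] .
  qed
qed (simp add: L2_approximable_zero)

lemma L2_approximable_limit:
  assumes f: "f \<in> L2_space M" and g: "\<And>n. L2_approximable M e (g n)"
    and lim: "\<And>x. x \<in> space M \<Longrightarrow> (\<lambda>n. g n x) \<longlonglongrightarrow> f x"
    and h: "integrable M h" "\<And>n x. x \<in> space M \<Longrightarrow> (cmod (g n x))\<^sup>2 \<le> h x"
  shows "L2_approximable M e f"
proof (rule L2_approximable_closure[OF f])
  have gL: "g n \<in> L2_space M" for n
    using g by (simp add: L2_approximable_def)
  have meas: "f \<in> borel_measurable M" "g n \<in> borel_measurable M" for n
    using f gL by (auto intro: L2_space_measurable)
  have "(\<lambda>n. LINT x|M. (cmod (f x - g n x))\<^sup>2) \<longlonglongrightarrow> (LINT x|M. 0)"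
  proof (rule integral_dominated_convergence)
    show "integrable M (\<lambda>x. 2 * (cmod (f x))\<^sup>2 + 2 * h x)"
      using f h by (simp add: L2_space_integrable)
    show "AE x in M. (\<lambda>n. (cmod (f x - g n x))\<^sup>2) \<longlonglongrightarrow> 0"
    proof (rule AE_I2)
      fix x assume "x \<in> space M"
      then have "(\<lambda>n. (cmod (f x - g n x))\<^sup>2) \<longlonglongrightarrow> (cmod (f x - f x))\<^sup>2"
        by (intro tendsto_intros lim)
      then show "(\<lambda>n. (cmod (f x - g n x))\<^sup>2) \<longlonglongrightarrow> 0" by simp
    qed
    fix n
    show "AE x in M. norm ((cmod (f x - g n x))\<^sup>2) \<le> 2 * (cmod (f x))\<^sup>2 + 2 * h x"
    proof (rule AE_I2)
      fix x assume "x \<in> space M"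
      then show "norm ((cmod (f x - g n x))\<^sup>2) \<le> 2 * (cmod (f x))\<^sup>2 + 2 * h x"
        using cmod_add_squared_le[of "f x" "- g n x"] h(2)[of x n] by simp
    qed
  qed (use meas in measurable)
  then have lim0: "(\<lambda>n. LINT x|M. (cmod (f x - g n x))\<^sup>2) \<longlonglongrightarrow> 0" by simp
  fix \<epsilon> :: real assume "\<epsilon> > 0"
  then have "\<forall>\<^sub>F n in sequentially. (LINT x|M. (cmod (f x - g n x))\<^sup>2) < \<epsilon>"
    using lim0 by (auto dest: order_tendstoD(2))
  then obtain n where "(LINT x|M. (cmod (f x - g n x))\<^sup>2) < \<epsilon>"
    by (auto simp: eventually_sequentially)
  then show "\<exists>g. L2_approximable M e g \<and> (LINT x|M. (cmod (f x - g x))\<^sup>2) < \<epsilon>"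
    using g by blast
qed

end

lemma L2_approximable_Bessel:
  assumes e: "L2_orthonormal M e" and f: "f \<in> L2_space M"
    and B: "\<And>\<epsilon>. \<epsilon> > 0 \<Longrightarrow> \<exists>F. finite F \<and>
      (LINT x|M. (cmod (f x))\<^sup>2) - \<epsilon> < (\<Sum>i\<in>F. (cmod (L2_inner M f (e i)))\<^sup>2)"
  shows "L2_approximable M e f"
  unfolding L2_approximable_def
proof (intro conjI allI impI f)
  fix \<epsilon> :: real assume "\<epsilon> > 0"
  then obtain F where F: "finite F"
      "(LINT x|M. (cmod (f x))\<^sup>2) - \<epsilon> < (\<Sum>i\<in>F. (cmod (L2_inner M f (e i)))\<^sup>2)"
    using B by blast
  then have "(LINT x|M. (cmod (f x - (\<Sum>i\<in>F. L2_inner M f (e i) * e i x)))\<^sup>2) < \<epsilon>"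
    by (simp add: Bessel_identity[OF e f])
  then show "\<exists>F c. finite F \<and> (LINT x|M. (cmod (f x - (\<Sum>i\<in>F. c i * e i x)))\<^sup>2) < \<epsilon>"
    using F(1) by (intro exI[of _ F] exI[of _ "\<lambda>i. L2_inner M f (e i)"]) simp
qed

text \<open>
  For a fixed bounded window, the Borel sets whose trace on the window has an approximable indicator
  form a Dynkin system that contains the intersection-stable generator of closed intervals. The window
  keeps all indicators square-integrable, so complements and countable disjoint unions can be formed by
  differences and dominated limits. A general function is the dominated limit of truncated simple functions.
\<close>

lemma L2_total_intervals:
  fixes e :: "'i \<Rightarrow> real \<Rightarrow> complex"
  assumes eL: "\<And>i. e i \<in> L2_space lborel"
    and intervals: "\<And>a b. a \<le> b \<Longrightarrow> L2_approximable lborel e (indicator {a..b})"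
  shows "L2_total lborel e"
proof -
  have ind: "L2_approximable lborel e (indicator (A \<inter> {-real n..real n}))" if "A \<in> sets borel" for A n
  proof -
    let ?I = "{-real n..real n}"
    have bd: "integrable lborel (indicator ?I :: real \<Rightarrow> real)"
      by (rule integrable_real_indicator) auto
    have L2: "indicator (B \<inter> ?I) \<in> L2_space lborel" if "B \<in> sets borel" for B
    proof (rule L2_space_dominated[OF _ bd])
      show "indicator (B \<inter> ?I) \<in> borel_measurable lborel"
        using that by (intro borel_measurable_indicator) auto
      show "(cmod (indicator (B \<inter> ?I) x))\<^sup>2 \<le> indicator ?I x" for x
        by (cases "x \<in> B"; cases "x \<in> ?I") simp_all
    qed
    have "Int_stable (range (\<lambda>(a, b). {a..b::real}))"
      by (auto simp: Int_stable_def)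
    moreover have "range (\<lambda>(a, b). {a..b::real}) \<subseteq> Pow UNIV" by auto
    moreover have "A \<in> sigma_sets UNIV (range (\<lambda>(a, b). {a..b}))"
      using that by (simp add: borel_eq_atLeastAtMost)
    ultimately show ?thesis
    proof (induction rule: sigma_sets_induct_disjoint)
      case (basic A)
      then obtain a b where "A = {a..b}" by auto
      then have eq: "A \<inter> ?I = {max a (- real n)..min b (real n)}" by auto
      show ?case
      proof (cases "max a (- real n) \<le> min b (real n)")
        case True
        then show ?thesis unfolding eq by (rule intervals)
      next
        case False
        show ?thesis
          unfolding eq atLeastatMost_empty[OF not_le_imp_less[OF False]]
          by (rule L2_approximable_indicator_empty[OF eL])
      qed
    next
      case empty
      then show ?case
        unfolding Int_empty_left by (rule L2_approximable_indicator_empty[OF eL])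
    next
      case (compl A)
      have "L2_approximable lborel e (\<lambda>x. indicator ?I x - indicator (A \<inter> ?I) x)"
        by (rule L2_approximable_diff[OF eL intervals compl.IH]) simp
      also have "(\<lambda>x. indicator ?I x - indicator (A \<inter> ?I) x) = (indicator ((UNIV - A) \<inter> ?I) :: real \<Rightarrow> complex)"
        by (rule ext) (simp split: split_indicator)
      finally show ?case .
    next
      case (union A)
      have meas: "A i \<in> sets borel" for i
        using union.hyps(2) by (auto simp: borel_eq_atLeastAtMost)
      define g where "g N x = (\<Sum>i<N. indicator (A i \<inter> ?I) x :: complex)" for N :: nat and x
      have g: "g N = indicator ((\<Union>i<N. A i) \<inter> ?I)" for N
      proof
        fix x
        show "g N x = indicator ((\<Union>i<N. A i) \<inter> ?I) x"
        proof (cases "\<exists>j<N. x \<in> A j \<inter> ?I")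
          case True
          then obtain j where j: "j < N" "x \<in> A j" "x \<in> ?I" by auto
          have "x \<in> A i \<longleftrightarrow> i = j" for i
            using disjoint_family_onD[OF union.hyps(1) UNIV_I UNIV_I, of i j] j by blast
          then have "indicator (A i \<inter> ?I) x = (if i = j then 1 else 0 :: complex)" for i
            using j by (simp add: indicator_def)
          then have "g N x = 1"
            unfolding g_def using j by simp
          moreover have "x \<in> (\<Union>i<N. A i) \<inter> ?I"
            using j by blast
          ultimately show ?thesis by simp
        next
          case False
          then have "g N x = 0"
            unfolding g_def by (auto intro!: sum.neutral simp: indicator_def)
          moreover have "x \<notin> (\<Union>i<N. A i) \<inter> ?I"
            using False by blast
          ultimately show ?thesis by simp
        qed
      qed
      show ?case
      proof (rule L2_approximable_limit[where g = g and h = "indicator ?I", OF eL])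
        show "indicator (\<Union> (range A) \<inter> ?I) \<in> L2_space lborel"
          by (intro L2 sets.countable_UN image_subsetI meas)
        show "L2_approximable lborel e (g N)" for N
          unfolding g_def[abs_def] by (rule L2_approximable_sum[OF eL union.IH])
        show "(\<lambda>N. g N x) \<longlonglongrightarrow> indicator (\<Union> (range A) \<inter> ?I) x" for x
          using LIMSEQ_indicator_UN[of "\<lambda>i. A i \<inter> ?I" x] unfolding g by (simp only: Int_UN_distrib2 UN_simps)
        show "(cmod (g N x))\<^sup>2 \<le> indicator ?I x" for N x
          unfolding g by (cases "x \<in> (\<Union>i<N. A i)"; cases "x \<in> ?I") simp_all
        show "integrable lborel (indicator ?I :: real \<Rightarrow> real)"
          by (rule bd)
      qed
    qed
  qed
  have "L2_approximable lborel e f" if f: "f \<in> L2_space lborel" for f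
  proof -
    have "f \<in> borel_measurable lborel" using f by (rule L2_space_measurable)
    then obtain s where s: "\<And>i. simple_function lborel (s i)" "\<And>x. (\<lambda>i. s i x) \<longlonglongrightarrow> f x"
        "\<And>i x. dist (s i x) 0 \<le> 2 * dist (f x) 0"
      using borel_measurable_implies_sequence_metric[of f lborel 0] by auto
    define g where "g n x = (\<Sum>y\<in>range (s n). y * indicator (s n -` {y} \<inter> {-real n..real n}) x)" for n x
    have fin: "finite (range (s n))" and sm: "s n -` {y} \<in> sets borel" for n y
      using simple_functionD[OF s(1)[of n]] by auto
    have g: "g n x = s n x * indicator {-real n..real n} x" for n x
    proof -
      have "g n x = (\<Sum>y\<in>range (s n). if y = s n x then s n x * indicator {-real n..real n} x else 0)"
        unfolding g_def by (intro sum.cong) (auto split: split_indicator)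
      then show ?thesis
        using fin by simp
    qed
    show ?thesis
    proof (rule L2_approximable_limit[where g = g and h = "\<lambda>x. 4 * (cmod (f x))\<^sup>2", OF eL f])
      show "L2_approximable lborel e (g n)" for n
        unfolding g_def by (intro L2_approximable_sum L2_approximable_scale eL ind sm)
      show "integrable lborel (\<lambda>x. 4 * (cmod (f x))\<^sup>2)"
        using f by (simp add: L2_space_integrable)
      show "(\<lambda>n. g n x) \<longlonglongrightarrow> f x" for x
      proof (rule Lim_transform_eventually[OF s(2)])
        show "\<forall>\<^sub>F n in sequentially. s n x = g n x"
          using eventually_ge_at_top[of "nat \<lceil>\<bar>x\<bar>\<rceil>"]
        proof eventually_elim
          case (elim n)
          then have "x \<in> {-real n..real n}"
            unfolding atLeastAtMost_iff by linarith
          then show ?case by (simp add: g)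
        qed
      qed
      show "(cmod (g n x))\<^sup>2 \<le> 4 * (cmod (f x))\<^sup>2" for n x
      proof -
        have "cmod (g n x) \<le> 2 * cmod (f x)"
          using s(3)[of n x] by (auto simp: g split: split_indicator)
        then have "(cmod (g n x))\<^sup>2 \<le> (2 * cmod (f x))\<^sup>2"
          by (intro power_mono) auto
        then show ?thesis by (simp add: power_mult_distrib)
      qed
    qed
  qed
  then show ?thesis
    unfolding L2_total_def by (blast intro: L2_approximable_imp_norm)
qed

section \<open>Periodisation\<close>

lemma indicator_eq_sum_unit_intervals:
  "indicator {-real N..<real N} t =
    (\<Sum>l\<in>{-int N..<int N}. indicator {of_int l..<of_int l + 1} t :: 'a::semiring_1)"
proof -
  have "indicator {of_int l..<of_int l + 1} t = (if l = \<lfloor>t\<rfloor> then 1 else 0 :: 'a)" for l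
  proof -
    have "t \<in> {of_int l..<of_int l + 1} \<longleftrightarrow> l = \<lfloor>t\<rfloor>"
      unfolding atLeastLessThan_iff by linarith
    then show ?thesis by (simp add: indicator_def)
  qed
  moreover have "t \<in> {-real N..<real N} \<longleftrightarrow> \<lfloor>t\<rfloor> \<in> {-int N..<int N}"
    unfolding atLeastLessThan_iff by linarith
  ultimately show ?thesis
    by (simp add: indicator_def)
qed

lemma indicator_unit_interval_shift:
  "indicator {of_int l..<of_int l + 1} (of_int l + t) = (indicator {0..<1::real} t :: 'a::zero_neq_one)"
  by (simp add: indicator_def)

lemma periodization_integrable:
  fixes F :: "real \<Rightarrow> complex"
  assumes [measurable]: "F \<in> borel_measurable borel"
    and bound: "\<And>N t. (\<Sum>l\<in>{-int N..<int N}. norm (F (of_int l + t))) \<le> C"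
  shows "integrable lborel F"
proof (rule integrableI_bounded)
  define h where "h t = ennreal (norm (F t))" for t
  have [measurable]: "h \<in> borel_measurable borel" unfolding h_def by measurable
  have part: "(\<integral>\<^sup>+t. indicator {-real N..<real N} t * h t \<partial>lborel) \<le> ennreal C" for N
  proof -
    have "(\<integral>\<^sup>+t. indicator {-real N..<real N} t * h t \<partial>lborel) =
        (\<Sum>l\<in>{-int N..<int N}. \<integral>\<^sup>+t. indicator {of_int l..<of_int l + 1} t * h t \<partial>lborel)"
      unfolding indicator_eq_sum_unit_intervals sum_distrib_right by (rule nn_integral_sum) simp
    also have "\<dots> = (\<Sum>l\<in>{-int N..<int N}. \<integral>\<^sup>+t. indicator {0..<1} t * h (of_int l + t) \<partial>lborel)"
    proof (rule sum.cong[OF refl])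
      fix l :: int
      show "(\<integral>\<^sup>+t. indicator {of_int l..<of_int l + 1} t * h t \<partial>lborel) =
          (\<integral>\<^sup>+t. indicator {0..<1} t * h (of_int l + t) \<partial>lborel)"
        by (subst nn_integral_real_affine[where c = 1 and t = "of_int l"])
          (simp_all only: indicator_unit_interval_shift mult_1, simp_all)
    qed
    also have "\<dots> = (\<integral>\<^sup>+t. indicator {0..<1} t * (\<Sum>l\<in>{-int N..<int N}. h (of_int l + t)) \<partial>lborel)"
      unfolding sum_distrib_left by (rule nn_integral_sum[symmetric]) simp
    also have "\<dots> \<le> (\<integral>\<^sup>+t. ennreal C * indicator {0..<1::real} t \<partial>lborel)"
    proof (rule nn_integral_mono)
      fix t :: real
      have "(\<Sum>l\<in>{-int N..<int N}. h (of_int l + t)) \<le> ennreal C"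
        unfolding h_def using bound[of t N] by (simp add: ennreal_leI)
      then show "indicator {0..<1} t * (\<Sum>l\<in>{-int N..<int N}. h (of_int l + t)) \<le> ennreal C * indicator {0..<1} t"
        by (simp split: split_indicator)
    qed
    also have "\<dots> = ennreal C"
      by (subst nn_integral_cmult_indicator) simp_all
    finally show ?thesis .
  qed
  have "(\<integral>\<^sup>+t. h t \<partial>lborel) = (\<integral>\<^sup>+t. (SUP N. indicator {-real N..<real N} t * h t) \<partial>lborel)"
  proof (rule nn_integral_cong)
    fix t
    obtain N where N: "\<bar>t\<bar> < real N" using reals_Archimedean2 by blast
    show "h t = (SUP N. indicator {-real N..<real N} t * h t)"
    proof (rule antisym)
      have "t \<in> {-real N..<real N}"
        using N unfolding atLeastLessThan_iff by linarith
      then have "h t = indicator {-real N..<real N} t * h t" by simp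
      also have "\<dots> \<le> (SUP N. indicator {-real N..<real N} t * h t)" by (rule SUP_upper) simp
      finally show "h t \<le> (SUP N. indicator {-real N..<real N} t * h t)" .
      show "(SUP N. indicator {-real N..<real N} t * h t) \<le> h t"
        by (rule SUP_least) (simp split: split_indicator)
    qed
  qed
  also have "\<dots> = (SUP N. \<integral>\<^sup>+t. indicator {-real N..<real N} t * h t \<partial>lborel)"
    by (rule nn_integral_monotone_convergence_SUP)
      (auto intro!: incseq_SucI le_funI split: split_indicator)
  also have "\<dots> \<le> ennreal C"
    by (intro SUP_least part)
  finally show "(\<integral>\<^sup>+t. ennreal (norm (F t)) \<partial>lborel) < \<infinity>"
    unfolding h_def infinity_ennreal_def by (rule le_less_trans) simp
qed simp

text \<open>
  Cutting the line into unit intervals and translating them to \<open>{0..<1}\<close> turns the integral over the line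
  into the integral of the sum of all integer translates.
\<close>

lemma periodization_integral:
  fixes F :: "real \<Rightarrow> complex"
  assumes [measurable]: "F \<in> borel_measurable borel"
    and bound: "\<And>N t. (\<Sum>l\<in>{-int N..<int N}. norm (F (of_int l + t))) \<le> C"
    and lim: "\<And>t. (\<lambda>N. \<Sum>l\<in>{-int N..<int N}. F (of_int l + t)) \<longlonglongrightarrow> P t"
  shows "(LINT t|lborel. F t) = (LINT t|lborel. indicator {0..<1} t *\<^sub>R P t)"
proof -
  have F: "integrable lborel F"
    by (rule periodization_integrable[OF assms(1) bound])
  have [measurable]: "P \<in> borel_measurable borel"
    by (rule borel_measurable_LIMSEQ_metric[OF _ lim]) measurable
  have indF: "integrable lborel (\<lambda>t. indicator A t *\<^sub>R F t)" if "A \<in> sets borel" for A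
    using F that by (intro integrable_mult_indicator) auto
  have shift: "integrable lborel (\<lambda>t. indicator {0..<1} t *\<^sub>R F (of_int l + t))" for l
    using lborel_integrable_real_affine[OF F, of 1 "of_int l"]
    by (intro integrable_mult_indicator) auto
  have eq: "(LINT t|lborel. indicator {-real N..<real N} t *\<^sub>R F t) =
      (LINT t|lborel. indicator {0..<1} t *\<^sub>R (\<Sum>l\<in>{-int N..<int N}. F (of_int l + t)))" for N
  proof -
    have "(LINT t|lborel. indicator {-real N..<real N} t *\<^sub>R F t) =
        (\<Sum>l\<in>{-int N..<int N}. LINT t|lborel. indicator {of_int l..<of_int l + 1} t *\<^sub>R F t)"
      unfolding indicator_eq_sum_unit_intervals scaleR_sum_left
      by (rule Bochner_Integration.integral_sum) (simp add: indF)
    also have "\<dots> = (\<Sum>l\<in>{-int N..<int N}. LINT t|lborel. indicator {0..<1} t *\<^sub>R F (of_int l + t))"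
    proof (rule sum.cong[OF refl])
      fix l :: int
      show "(LINT t|lborel. indicator {of_int l..<of_int l + 1} t *\<^sub>R F t) =
          (LINT t|lborel. indicator {0..<1} t *\<^sub>R F (of_int l + t))"
        by (subst lborel_integral_real_affine[where c = 1 and t = "of_int l"])
          (simp_all only: indicator_unit_interval_shift mult_1, simp_all)
    qed
    also have "\<dots> = (LINT t|lborel. indicator {0..<1} t *\<^sub>R (\<Sum>l\<in>{-int N..<int N}. F (of_int l + t)))"
      unfolding scaleR_sum_right
      by (rule Bochner_Integration.integral_sum[symmetric]) (rule shift)
    finally show ?thesis .
  qed
  have "(\<lambda>N. LINT t|lborel. indicator {-real N..<real N} t *\<^sub>R F t) \<longlonglongrightarrow> (LINT t|lborel. F t)"
  proof (rule integral_dominated_convergence[where w = "\<lambda>t. norm (F t)"])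
    show "AE t in lborel. (\<lambda>N. indicator {-real N..<real N} t *\<^sub>R F t) \<longlonglongrightarrow> F t"
    proof (rule AE_I2)
      fix t :: real
      obtain K where K: "\<bar>t\<bar> < real K" using reals_Archimedean2 by blast
      have "\<forall>\<^sub>F N in sequentially. indicator {-real N..<real N} t *\<^sub>R F t = F t"
        using eventually_ge_at_top[of K]
      proof eventually_elim
        case (elim N)
        then have "t \<in> {-real N..<real N}"
          using K unfolding atLeastLessThan_iff by linarith
        then show ?case by simp
      qed
      then show "(\<lambda>N. indicator {-real N..<real N} t *\<^sub>R F t) \<longlonglongrightarrow> F t"
        by (rule tendsto_eventually)
    qed
    show "AE t in lborel. norm (indicator {-real N..<real N} t *\<^sub>R F t) \<le> norm (F t)" for N
      by (rule AE_I2) (simp split: split_indicator)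
  qed (use F in auto)
  moreover have "(\<lambda>N. LINT t|lborel. indicator {0..<1} t *\<^sub>R (\<Sum>l\<in>{-int N..<int N}. F (of_int l + t)))
      \<longlonglongrightarrow> (LINT t|lborel. indicator {0..<1} t *\<^sub>R P t)"
  proof (rule integral_dominated_convergence[where w = "\<lambda>t. C * indicator {0..<1} t"])
    show "integrable lborel (\<lambda>t. C * indicator {0..<1::real} t)"
      by (intro integrable_mult_right integrable_real_indicator) auto
    show "AE t in lborel. (\<lambda>N. indicator {0..<1} t *\<^sub>R (\<Sum>l\<in>{-int N..<int N}. F (of_int l + t)))
        \<longlonglongrightarrow> indicator {0..<1} t *\<^sub>R P t"
      by (intro AE_I2 tendsto_intros lim)
    have "norm (\<Sum>l\<in>{-int N..<int N}. F (of_int l + t)) \<le> C" for N t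
      by (rule order_trans[OF norm_sum bound])
    then show "AE t in lborel. norm (indicator {0..<1} t *\<^sub>R (\<Sum>l\<in>{-int N..<int N}. F (of_int l + t)))
        \<le> C * indicator {0..<1} t" for N
      by (intro AE_I2) (simp split: split_indicator)
  qed measurable
  ultimately show ?thesis
    unfolding eq by (rule LIMSEQ_unique)
qed

section \<open>Modulated translates of the cardinal sine\<close>

definition unit_char :: "real \<Rightarrow> complex" where
  "unit_char x = cis (2 * pi * x)"

lemma unit_char_0 [simp]: "unit_char 0 = 1"
  by (simp add: unit_char_def)

lemma norm_unit_char [simp]: "norm (unit_char x) = 1"
  by (simp add: unit_char_def)

lemma unit_char_add: "unit_char (x + y) = unit_char x * unit_char y"
  by (simp add: unit_char_def cis_mult distrib_left)

lemma cnj_unit_char: "cnj (unit_char x) = unit_char (- x)"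
  by (simp add: unit_char_def cis_cnj)

lemma unit_char_of_int [simp]: "unit_char (of_int n) = 1"
  by (simp add: unit_char_def cis_multiple_2pi)

lemma unit_char_int_shift: "unit_char (of_int n * (of_int l + t)) = unit_char (of_int n * t)"
  by (simp only: distrib_left unit_char_add of_int_mult[symmetric] unit_char_of_int mult_1)

lemma continuous_on_unit_char [continuous_intros]:
  "continuous_on A f \<Longrightarrow> continuous_on A (\<lambda>x. unit_char (f x))"
  unfolding unit_char_def by (intro continuous_intros)

lemma borel_measurable_unit_char [measurable]: "unit_char \<in> borel_measurable borel"
  by (intro borel_measurable_continuous_onI continuous_intros)

lemma integral_unit_char_period:
  "(LINT t|lborel. indicator {0..<1} t *\<^sub>R unit_char (of_int n * t)) = (if n = 0 then 1 else 0)"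
proof (cases "n = 0")
  case False
  define a where "a = 2 * pi * \<i> * of_int n"
  have a: "a \<noteq> 0" using False by (simp add: a_def)
  have E: "unit_char (of_int n * t) = exp (a * of_real t)" for t
    by (simp add: unit_char_def cis_conv_exp a_def mult_ac)
  have "(LINT t|lborel. indicator {0..<1} t *\<^sub>R unit_char (of_int n * t)) =
      (LINT t|lborel. indicator {0..1} t *\<^sub>R exp (a * of_real t))"
  proof (rule integral_cong_AE)
    show "AE t in lborel. indicator {0..<1} t *\<^sub>R unit_char (of_int n * t) =
        indicator {0..1} t *\<^sub>R exp (a * of_real t)"
      using AE_lborel_singleton[of "1::real"] by eventually_elim (auto simp: E indicator_def)
  qed (simp_all flip: E)
  also have "\<dots> = exp (a * of_real 1) / a - exp (a * of_real 0) / a"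
  proof (rule integral_FTC_atLeastAtMost)
    show "((\<lambda>x. exp (a * of_real x) / a) has_vector_derivative exp (a * of_real x))
        (at x within {0..1})" for x :: real
    proof -
      have "((\<lambda>z. exp (a * z) / a) has_field_derivative exp (a * of_real x)) (at (of_real x))"
        using a by (auto intro!: derivative_eq_intros)
      then show ?thesis
        by (rule has_vector_derivative_real_field)
    qed
  qed (auto intro!: continuous_intros)
  also have "\<dots> = 0"
    using unit_char_of_int[of n] E[of 1] by simp
  finally show ?thesis using False by simp
qed simp

text \<open>
  The Fourier transform of an atom lives on the unit interval centred at \<open>\<eta>\<close>. The factor
  \<open>exp (2 * pi * \<i> * \<eta> * (t - a))\<close> is translated along with the \<open>sinc\<close>, as in the wavelets.
\<close>

definition atom :: "int \<Rightarrow> real \<Rightarrow> real \<Rightarrow> complex" where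
  "atom \<eta> a t = unit_char (of_int \<eta> * (t - a)) * of_real (nsinc (t - a))"

lemma borel_measurable_atom [measurable]: "atom \<eta> a \<in> borel_measurable borel"
  unfolding atom_def[abs_def] by measurable

lemma atom_product:
  "atom \<eta> a t * cnj (atom \<theta> b t) = unit_char (of_int \<theta> * b - of_int \<eta> * a) *
     (unit_char (of_int (\<eta> - \<theta>) * t) * of_real (nsinc (t - a) * nsinc (t - b)))"
proof -
  have "of_int \<eta> * (t - a) + - (of_int \<theta> * (t - b)) =
      (of_int \<theta> * b - of_int \<eta> * a) + of_int (\<eta> - \<theta>) * t"
    by (simp add: algebra_simps)
  then have "unit_char (of_int \<eta> * (t - a)) * unit_char (- (of_int \<theta> * (t - b))) =
      unit_char (of_int \<theta> * b - of_int \<eta> * a) * unit_char (of_int (\<eta> - \<theta>) * t)"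
    by (simp only: unit_char_add[symmetric])
  then show ?thesis
    by (simp add: atom_def cnj_unit_char mult_ac)
qed

text \<open>
  The exponential is invariant under integer translations, so the periodisation of \<open>F\<close> is the
  exponential times the sampling series, whose value \<open>nsinc (b - a)\<close> does not depend on \<open>t\<close>. Integrating
  over one period leaves only the frequency \<open>0\<close>.
\<close>

lemma
  fixes n :: int and a b :: real
  defines "F \<equiv> \<lambda>t. unit_char (of_int n * t) * of_real (nsinc (t - a) * nsinc (t - b))"
  shows nsinc_product_integrable: "integrable lborel F"
    and nsinc_product_integral: "(LINT t|lborel. F t) = (if n = 0 then of_real (nsinc (b - a)) else 0)"
proof -
  have meas: "F \<in> borel_measurable borel" unfolding F_def by measurable
  have shift: "F (of_int l + t) = unit_char (of_int n * t) *
      of_real (nsinc ((a - t) - of_int l) * nsinc ((b - t) - of_int l))" for l t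
    unfolding F_def unit_char_int_shift using nsinc_commute[of "of_int l + t"] by (simp add: algebra_simps)
  have bound: "(\<Sum>l\<in>{-int N..<int N}. norm (F (of_int l + t))) \<le> 1" for N t
    unfolding shift norm_mult norm_unit_char mult_1 norm_of_real by (rule sum_abs_nsinc_products_le)
  show "integrable lborel F"
    by (rule periodization_integrable[OF meas bound])
  have "(\<lambda>N. unit_char (of_int n * t) *
      of_real (\<Sum>l\<in>{-int N..<int N}. nsinc ((a - t) - of_int l) * nsinc ((b - t) - of_int l))) \<longlonglongrightarrow>
      unit_char (of_int n * t) * of_real (nsinc ((a - t) - (b - t)))" for t
    by (intro tendsto_mult tendsto_const tendsto_of_real nsinc_sampling)
  then have lim: "(\<lambda>N. \<Sum>l\<in>{-int N..<int N}. F (of_int l + t)) \<longlonglongrightarrow>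
      unit_char (of_int n * t) * of_real (nsinc (b - a))" for t
    using nsinc_commute[of a b] unfolding shift of_real_sum sum_distrib_left by simp
  have "(LINT t|lborel. F t) =
      (LINT t|lborel. (indicator {0..<1} t *\<^sub>R unit_char (of_int n * t)) * of_real (nsinc (b - a)))"
    using periodization_integral[OF meas bound lim] by simp
  then show "(LINT t|lborel. F t) = (if n = 0 then of_real (nsinc (b - a)) else 0)"
    unfolding integral_mult_left_zero integral_unit_char_period by simp
qed

lemma atom_L2: "atom \<eta> a \<in> L2_space lborel"
proof -
  have "(cmod (atom \<eta> a t))\<^sup>2 = cmod (unit_char (of_int 0 * t) * of_real (nsinc (t - a) * nsinc (t - a)))" for t
    by (simp add: atom_def norm_mult power2_eq_square)
  then show ?thesis
    using nsinc_product_integrable[of 0 a a] by (simp add: L2_space_def integrable_norm)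
qed

lemma atom_inner:
  "L2_inner lborel (atom \<eta> a) (atom \<theta> b) = (if \<eta> = \<theta> then atom \<eta> a b else 0)"
  unfolding L2_inner_def atom_product integral_mult_right_zero nsinc_product_integral
  by (simp add: atom_def right_diff_distrib)

section \<open>Wavelets of one block of frequencies\<close>

lemma sum_int_interval: "(\<Sum>\<eta>\<in>{m..<m + int M}. g \<eta>) = (\<Sum>k<M. g (m + int k))"
proof -
  have "bij_betw (\<lambda>k. m + int k) {..<M} {m..<m + int M}"
    by (rule bij_betwI[where g = "\<lambda>\<eta>. nat (\<eta> - m)"]) auto
  then show ?thesis
    by (rule sum.reindex_bij_betw[symmetric])
qed

text \<open>
  The Dirichlet kernel \<open>(\<Sum>k<M. exp (2 * pi * \<i> * k * x))\<close> has the denominator \<open>sin (pi * x)\<close>, which the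
  \<open>sinc\<close> cancels. On the Fourier side, \<open>M\<close> adjacent unit intervals are glued to one interval of length \<open>M\<close>.
\<close>

lemma sum_unit_char_mult_nsinc:
  "(\<Sum>k<M. unit_char (of_nat k * x)) * of_real (nsinc x) =
    of_nat M * unit_char ((of_nat M - 1) / 2 * x) * of_real (nsinc (of_nat M * x))"
proof (cases "x = 0")
  case False
  have cis: "cis (pi * x) - cis (- (pi * x)) = 2 * \<i> * of_real (sin (pi * x))" for x
    by (simp add: complex_eq_iff)
  have tel: "(\<Sum>k<M. unit_char (of_nat k * x)) * (cis (pi * x) - cis (- (pi * x))) =
      unit_char ((of_nat M - 1) / 2 * x) * (cis (pi * (of_nat M * x)) - cis (- (pi * (of_nat M * x))))"
  proof (induction M)
    case (Suc M)
    then show ?case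
      by (simp add: distrib_right right_diff_distrib unit_char_def cis_mult)
        (simp add: algebra_simps)
  qed simp
  have "(\<Sum>k<M. unit_char (of_nat k * x)) * of_real (sin (pi * x)) =
      unit_char ((of_nat M - 1) / 2 * x) * of_real (sin (pi * (of_nat M * x)))"
    using tel unfolding cis by simp
  then show ?thesis
    unfolding pi_mult_nsinc[symmetric] of_real_mult using False by (simp add: mult_ac)
qed simp

definition block :: "int \<Rightarrow> nat \<Rightarrow> int set" where
  "block m M = {m..<m + int M}"

lemma sum_atom_block:
  "(\<Sum>\<eta>\<in>block m M. atom \<eta> a t) = of_nat M *
     unit_char ((of_int m + (of_nat M - 1) / 2) * (t - a)) * of_real (nsinc (of_nat M * (t - a)))"
proof -
  have "atom (m + int k) a t =
      unit_char (of_int m * (t - a)) * (unit_char (of_nat k * (t - a)) * of_real (nsinc (t - a)))" for k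
    by (simp only: atom_def of_int_add of_int_of_nat_eq distrib_right unit_char_add mult.assoc)
  then have "(\<Sum>\<eta>\<in>block m M. atom \<eta> a t) =
      unit_char (of_int m * (t - a)) * ((\<Sum>k<M. unit_char (of_nat k * (t - a))) * of_real (nsinc (t - a)))"
    unfolding block_def sum_int_interval by (simp only: sum_distrib_left sum_distrib_right)
  then show ?thesis
    unfolding sum_unit_char_mult_nsinc distrib_right unit_char_add by (simp add: mult_ac)
qed

definition block_wavelet :: "int \<Rightarrow> nat \<Rightarrow> int \<Rightarrow> real \<Rightarrow> complex" where
  "block_wavelet m M l t = of_real (1 / sqrt (of_nat M)) * (\<Sum>\<eta>\<in>block m M. atom \<eta> (of_int l / of_nat M) t)"

lemma block_wavelet_L2: "block_wavelet m M l \<in> L2_space lborel"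
  unfolding block_wavelet_def[abs_def] by (intro L2_space_scale L2_space_sum atom_L2)

lemma L2_inner_scale_sum:
  assumes f: "\<And>i. i \<in> A \<Longrightarrow> f i \<in> L2_space M" and g: "\<And>j. j \<in> B \<Longrightarrow> g j \<in> L2_space M"
  shows "L2_inner M (\<lambda>x. c * (\<Sum>i\<in>A. f i x)) (\<lambda>x. d * (\<Sum>j\<in>B. g j x)) =
    c * cnj d * (\<Sum>i\<in>A. \<Sum>j\<in>B. L2_inner M (f i) (g j))"
proof -
  have eq: "c * (\<Sum>i\<in>A. f i x) * cnj (d * (\<Sum>j\<in>B. g j x)) =
      c * cnj d * (\<Sum>i\<in>A. \<Sum>j\<in>B. f i x * cnj (g j x))" for x
    unfolding complex_cnj_mult cnj_sum sum_product[symmetric] by (simp only: mult_ac)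
  show ?thesis
    unfolding L2_inner_def eq integral_mult_right_zero using L2_product_integrable[OF f g] by simp
qed

lemma block_wavelet_inner_eq:
  "L2_inner lborel (block_wavelet m M l) (block_wavelet m' M' l') =
    of_real (1 / (sqrt (of_nat M) * sqrt (of_nat M'))) * (\<Sum>\<eta>\<in>block m M. \<Sum>\<theta>\<in>block m' M'.
      if \<eta> = \<theta> then atom \<eta> (of_int l / of_nat M) (of_int l' / of_nat M') else 0)"
  unfolding block_wavelet_def[abs_def] L2_inner_scale_sum[OF atom_L2 atom_L2] atom_inner by simp

lemma block_wavelet_orthogonal:
  assumes "block m M \<inter> block m' M' = {}"
  shows "L2_inner lborel (block_wavelet m M l) (block_wavelet m' M' l') = 0"
proof -
  have "\<eta> \<noteq> \<theta>" if "\<eta> \<in> block m M" "\<theta> \<in> block m' M'" for \<eta> \<theta>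
    using assms that by blast
  then show ?thesis
    unfolding block_wavelet_inner_eq by (simp cong: sum.cong)
qed

text \<open>
  The double sum collapses to a sum of atoms at the point \<open>(l' - l) / M\<close>, and the glued \<open>sinc\<close> takes the
  value \<open>nsinc (l' - l)\<close> there.
\<close>

lemma block_wavelet_inner:
  assumes M: "M > 0"
  shows "L2_inner lborel (block_wavelet m M l) (block_wavelet m M l') = (if l = l' then 1 else 0)"
proof -
  have fin: "finite (block m M)" by (simp add: block_def)
  have "(\<Sum>\<eta>\<in>block m M. \<Sum>\<theta>\<in>block m M.
        if \<eta> = \<theta> then atom \<eta> (of_int l / of_nat M) (of_int l' / of_nat M) else 0) =
      (\<Sum>\<eta>\<in>block m M. atom \<eta> (of_int l / of_nat M) (of_int l' / of_nat M))"
    using fin by simp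
  also have "\<dots> = (if l = l' then of_nat M else 0)"
  proof -
    have "of_nat M * (of_int l' / of_nat M - of_int l / of_nat M) = (of_int (l' - l) :: real)"
      using M by (simp add: field_simps)
    then show ?thesis
      unfolding sum_atom_block by (simp only: nsinc_of_int) simp
  qed
  finally show ?thesis
    unfolding block_wavelet_inner_eq using M by simp
qed

lemma block_wavelet_product:
  assumes M: "M > 0"
  shows "block_wavelet m M l t * cnj (block_wavelet m M l s) =
    of_nat M * unit_char ((of_int m + (of_nat M - 1) / 2) * (t - s)) *
      of_real (nsinc (of_nat M * t - of_int l) * nsinc (of_nat M * s - of_int l))"
proof -
  define c where "c = of_int m + (of_nat M - 1) / (2::real)"
  have bw: "block_wavelet m M l u = of_real (sqrt (of_nat M)) * unit_char (c * (u - of_int l / of_nat M)) *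
      of_real (nsinc (of_nat M * u - of_int l))" for u
  proof -
    have "of_nat M * (u - of_int l / of_nat M) = of_nat M * u - (of_int l :: real)"
      using M by (simp add: field_simps)
    moreover have "of_real (1 / sqrt (of_nat M)) * of_nat M = complex_of_real (sqrt (of_nat M))"
    proof -
      have "complex_of_real (1 / sqrt (of_nat M) * of_nat M) = of_real (sqrt (of_nat M))"
        using M by (simp add: real_div_sqrt)
      then show ?thesis by simp
    qed
    ultimately show ?thesis
      unfolding block_wavelet_def sum_atom_block c_def[symmetric] by (simp only: mult.assoc[symmetric])
  qed
  have "c * (t - of_int l / of_nat M) + - (c * (s - of_int l / of_nat M)) = c * (t - s)"
    by (simp add: algebra_simps)
  then have chars: "unit_char (c * (t - of_int l / of_nat M)) * unit_char (- (c * (s - of_int l / of_nat M))) =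
      unit_char (c * (t - s))"
    by (simp only: unit_char_add[symmetric])
  have sqrts: "complex_of_real (sqrt (real M)) * complex_of_real (sqrt (real M)) = of_nat M"
    by (simp flip: of_real_mult)
  have "block_wavelet m M l t * cnj (block_wavelet m M l s) =
      (complex_of_real (sqrt (real M)) * complex_of_real (sqrt (real M))) *
      (unit_char (c * (t - of_int l / of_nat M)) * unit_char (- (c * (s - of_int l / of_nat M)))) *
      of_real (nsinc (of_nat M * t - of_int l) * nsinc (of_nat M * s - of_int l))"
    unfolding bw complex_cnj_mult cnj_unit_char complex_cnj_complex_of_real of_real_mult
    by (simp only: mult_ac)
  then show ?thesis
    unfolding chars sqrts unfolding c_def .
qed

lemma sum_block_wavelet_product:
  assumes M: "M > 0"
  shows "(\<Sum>l\<in>L. block_wavelet m M l t * cnj (block_wavelet m M l s)) =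
    of_nat M * unit_char ((of_int m + (of_nat M - 1) / 2) * (t - s)) *
      of_real (\<Sum>l\<in>L. nsinc (of_nat M * t - of_int l) * nsinc (of_nat M * s - of_int l))"
  unfolding of_real_sum sum_distrib_left block_wavelet_product[OF M] ..

text \<open>
  Since the wavelet is a dilated \<open>sinc\<close> up to a phase, this is the sampling identity at the points \<open>M * t\<close>
  and \<open>M * s\<close>. The limit, written as a sum of atoms, can be added over adjacent blocks.
\<close>

lemma block_wavelet_kernel:
  assumes M: "M > 0"
  shows "(\<lambda>N. \<Sum>l\<in>{-int N..<int N}. block_wavelet m M l t * cnj (block_wavelet m M l s)) \<longlonglongrightarrow>
    (\<Sum>\<eta>\<in>block m M. atom \<eta> s t)"
  unfolding sum_block_wavelet_product[OF M] sum_atom_block right_diff_distrib[of "of_nat M"]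
  by (intro tendsto_mult tendsto_const tendsto_of_real nsinc_sampling)

lemma norm_sum_block_wavelet_le:
  assumes M: "M > 0"
  shows "norm (\<Sum>l\<in>{-int N..<int N}. block_wavelet m M l t * cnj (block_wavelet m M l s)) \<le> of_nat M"
proof -
  have "norm (\<Sum>l\<in>{-int N..<int N}. block_wavelet m M l t * cnj (block_wavelet m M l s)) =
      of_nat M * \<bar>\<Sum>l\<in>{-int N..<int N}. nsinc (of_nat M * t - of_int l) * nsinc (of_nat M * s - of_int l)\<bar>"
    unfolding sum_block_wavelet_product[OF M]
    by (simp only: norm_mult norm_unit_char norm_of_real norm_of_nat mult_1_right)
  also have "\<dots> \<le> of_nat M * 1"
    by (intro mult_left_mono order_trans[OF sum_abs sum_abs_nsinc_products_le]) simp
  finally show ?thesis by simp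
qed

section \<open>The frequency bands of the wavelets\<close>

text \<open>
  Reflecting the half-open interval \<open>{2 ^ j..<2 ^ (j + 1)}\<close> of integers gives \<open>{1 - 2 ^ (j + 1)..<1 - 2 ^ j}\<close>,
  hence the shift by one in the start of the negative bands.
\<close>

fun band_start :: "wavelet_index \<Rightarrow> int" where
  "band_start (Low l) = 0"
| "band_start (Plus j l) = 2 ^ j"
| "band_start (Minus j l) = 1 - 2 ^ (j + 1)"

fun band_width :: "wavelet_index \<Rightarrow> nat" where
  "band_width (Low l) = 1"
| "band_width (Plus j l) = 2 ^ j"
| "band_width (Minus j l) = 2 ^ j"

fun position :: "wavelet_index \<Rightarrow> int" where
  "position (Low l) = l"
| "position (Plus j l) = l"
| "position (Minus j l) = l"

abbreviation band :: "wavelet_index \<Rightarrow> int set" where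
  "band i \<equiv> block (band_start i) (band_width i)"

lemma band_width_pos: "band_width i > 0"
  by (cases i) auto

lemma powr_half_eq_sqrt: "2 powr (real j / 2) = sqrt (2 ^ j)"
  by (simp add: powr_half_sqrt[symmetric] powr_realpow[symmetric] powr_powr)

lemma sum_block_dyadic:
  "(\<Sum>\<eta>\<in>block (2 ^ j) (2 ^ j). g \<eta>) = (\<Sum>\<eta> = 2 ^ j..2 ^ (j + 1) - 1. g (int \<eta>))"
proof -
  have "(2::nat) ^ (j + 1) > 0" by simp
  then have "{2 ^ j..2 ^ (j + 1) - 1} = {2 ^ j..<2 ^ (j + 1) :: nat}"
    unfolding set_eq_iff atLeastAtMost_iff atLeastLessThan_iff by linarith
  then have "block (2 ^ j) (2 ^ j) = int ` {2 ^ j..2 ^ (j + 1) - 1}"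
    by (simp add: block_def image_int_atLeastLessThan)
  then show ?thesis
    by (simp add: sum.reindex)
qed

lemma wavelet_eq_block_wavelet:
  "wavelet i = block_wavelet (band_start i) (band_width i) (position i)"
proof
  fix t
  show "wavelet i t = block_wavelet (band_start i) (band_width i) (position i) t"
  proof (cases i)
    case (Low l)
    have "{0..<1::int} = {0}" by auto
    then show ?thesis
      by (simp add: Low block_wavelet_def block_def atom_def phi_eq_nsinc)
  next
    case (Plus j l)
    have "(\<Sum>\<eta>\<in>block (2 ^ j) (2 ^ j). atom \<eta> (of_int l / 2 ^ j) t) =
        (\<Sum>\<eta> = 2 ^ j..2 ^ (j + 1) - 1. atom (int \<eta>) (of_int l / 2 ^ j) t)"
      by (rule sum_block_dyadic)
    then show ?thesis
      by (simp add: Plus block_wavelet_def phi_plus_def translate_def powr_half_eq_sqrt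
          atom_def unit_char_def cis_conv_exp phi_eq_nsinc mult_ac)
  next
    case (Minus j l)
    have "block (1 - 2 ^ (j + 1)) (2 ^ j) = uminus ` block (2 ^ j) (2 ^ j)"
      by (auto simp: block_def)
    then have "(\<Sum>\<eta>\<in>block (1 - 2 ^ (j + 1)) (2 ^ j). atom \<eta> (of_int l / 2 ^ j) t) =
        (\<Sum>\<eta>\<in>block (2 ^ j) (2 ^ j). atom (- \<eta>) (of_int l / 2 ^ j) t)"
      by (simp add: sum.reindex)
    also have "\<dots> = (\<Sum>\<eta> = 2 ^ j..2 ^ (j + 1) - 1. atom (- int \<eta>) (of_int l / 2 ^ j) t)"
      by (rule sum_block_dyadic)
    finally have "(\<Sum>\<eta>\<in>block (1 - 2 ^ (j + 1)) (2 ^ j). atom \<eta> (of_int l / 2 ^ j) t) =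
        (\<Sum>\<eta> = 2 ^ j..2 ^ (j + 1) - 1. atom (- int \<eta>) (of_int l / 2 ^ j) t)" .
    then show ?thesis
      by (simp add: Minus block_wavelet_def phi_minus_def translate_def powr_half_eq_sqrt
          atom_def unit_char_def cis_conv_exp phi_eq_nsinc mult_ac)
  qed
qed

lemma dyadic_unique:
  fixes x :: int
  assumes "2 ^ j \<le> x" "x < 2 ^ (j + 1)" "2 ^ k \<le> x" "x < 2 ^ (k + 1)"
  shows "j = k"
proof -
  have "(2::int) ^ j < 2 ^ (k + 1)" "(2::int) ^ k < 2 ^ (j + 1)"
    using assms by linarith+
  then have "j < k + 1" "k < j + 1"
    by (simp_all only: power_strict_increasing_iff one_less_numeral_iff semiring_norm)
  then show ?thesis by simp
qed

lemma band_cases: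
  "x \<in> band (Low l) \<longleftrightarrow> x = 0"
  "x \<in> band (Plus j l) \<longleftrightarrow> 2 ^ j \<le> x \<and> x < 2 ^ (j + 1)"
  "x \<in> band (Minus j l) \<longleftrightarrow> 2 ^ j \<le> - x \<and> - x < 2 ^ (j + 1)"
  by (auto simp: block_def)

text \<open>
  The sign of a frequency and the binary length of its absolute value determine the band that contains it.
\<close>

lemma band_disjoint_or_equal:
  assumes "x \<in> band i" "x \<in> band k"
  shows "band_start i = band_start k \<and> band_width i = band_width k \<and> (position i = position k \<longrightarrow> i = k)"
proof -
  have pos: "(2::int) ^ j > 0" for j :: nat by simp
  show ?thesis
  proof (cases i)
    case i: (Low a)
    then have x: "x = 0" using assms(1) by (simp only: band_cases)
    show ?thesis
    proof (cases k)
      case (Low b)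
      then show ?thesis using i by simp
    next
      case (Plus j b)
      then have "2 ^ j \<le> x" using assms(2) by (simp only: band_cases)
      then show ?thesis using x pos[of j] by linarith
    next
      case (Minus j b)
      then have "2 ^ j \<le> - x" using assms(2) by (simp only: band_cases)
      then show ?thesis using x pos[of j] by linarith
    qed
  next
    case i: (Plus j a)
    then have x: "2 ^ j \<le> x" "x < 2 ^ (j + 1)" using assms(1) by (simp_all only: band_cases)
    show ?thesis
    proof (cases k)
      case (Low b)
      then have "x = 0" using assms(2) by (simp only: band_cases)
      then show ?thesis using x pos[of j] by linarith
    next
      case (Plus j' b)
      then have "2 ^ j' \<le> x" "x < 2 ^ (j' + 1)" using assms(2) by (simp_all only: band_cases)
      then have "j = j'" by (rule dyadic_unique[OF x])
      then show ?thesis using i Plus by simp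
    next
      case (Minus j' b)
      then have "2 ^ j' \<le> - x" using assms(2) by (simp only: band_cases)
      then show ?thesis using x pos[of j] pos[of j'] by linarith
    qed
  next
    case i: (Minus j a)
    then have x: "2 ^ j \<le> - x" "- x < 2 ^ (j + 1)" using assms(1) by (simp_all only: band_cases)
    show ?thesis
    proof (cases k)
      case (Low b)
      then have "x = 0" using assms(2) by (simp only: band_cases)
      then show ?thesis using x pos[of j] by linarith
    next
      case (Plus j' b)
      then have "2 ^ j' \<le> x" using assms(2) by (simp only: band_cases)
      then show ?thesis using x pos[of j] pos[of j'] by linarith
    next
      case (Minus j' b)
      then have "2 ^ j' \<le> - x" "- x < 2 ^ (j' + 1)" using assms(2) by (simp_all only: band_cases)
      then have "j = j'" by (rule dyadic_unique[OF x])
      then show ?thesis using i Minus by simp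
    qed
  qed
qed

lemma wavelet_orthonormal: "L2_orthonormal lborel wavelet"
  unfolding L2_orthonormal_def
proof (intro conjI allI)
  fix i k
  show "wavelet i \<in> L2_space lborel"
    unfolding wavelet_eq_block_wavelet by (rule block_wavelet_L2)
  show "L2_inner lborel (wavelet i) (wavelet k) = (if i = k then 1 else 0)"
  proof (cases "band i \<inter> band k = {}")
    case True
    moreover have "band i \<noteq> {}"
      using band_width_pos[of i] by (simp add: block_def)
    ultimately have "i \<noteq> k" by auto
    then show ?thesis
      using True unfolding wavelet_eq_block_wavelet by (simp add: block_wavelet_orthogonal)
  next
    case False
    then obtain x where "x \<in> band i" "x \<in> band k" by auto
    from band_disjoint_or_equal[OF this] show ?thesis
      unfolding wavelet_eq_block_wavelet by (auto simp: block_wavelet_inner band_width_pos)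
  qed
qed

section \<open>The kernel of the first bands\<close>

text \<open>
  The finite sets of wavelets along which Bessel's inequality is shown to become an equality: \<open>N\<close> exhausts the
  translations, then \<open>J\<close> exhausts the bands.
\<close>

definition stage :: "nat \<Rightarrow> nat \<Rightarrow> wavelet_index set" where
  "stage J N = Low ` {-int N..<int N} \<union> (\<Union>j<J. Plus j ` {-int N..<int N} \<union> Minus j ` {-int N..<int N})"

lemma finite_stage: "finite (stage J N)"
  by (simp add: stage_def)

lemma sum_stage_0: "(\<Sum>i\<in>stage 0 N. g i) = (\<Sum>l\<in>{-int N..<int N}. g (Low l))"
  by (simp add: stage_def sum.reindex inj_on_def)

lemma sum_stage_Suc:
  "(\<Sum>i\<in>stage (Suc J) N. g i) = (\<Sum>i\<in>stage J N. g i) +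
    ((\<Sum>l\<in>{-int N..<int N}. g (Plus J l)) + (\<Sum>l\<in>{-int N..<int N}. g (Minus J l)))"
proof -
  let ?L = "{-int N..<int N}"
  have "stage (Suc J) N = stage J N \<union> (Plus J ` ?L \<union> Minus J ` ?L)"
    by (auto simp: stage_def lessThan_Suc)
  moreover have "stage J N \<inter> (Plus J ` ?L \<union> Minus J ` ?L) = {}"
    by (auto simp: stage_def)
  moreover have "Plus J ` ?L \<inter> Minus J ` ?L = {}"
    by auto
  ultimately have "(\<Sum>i\<in>stage (Suc J) N. g i) =
      (\<Sum>i\<in>stage J N. g i) + (sum g (Plus J ` ?L) + sum g (Minus J ` ?L))"
    by (simp add: sum.union_disjoint finite_stage)
  then show ?thesis
    by (simp add: sum.reindex inj_on_def)
qed

text \<open>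
  The first \<open>J\<close> pairs of bands together with \<open>{0}\<close> make up the frequencies \<open>\<eta>\<close> with \<open>\<bar>\<eta>\<bar> < 2 ^ J\<close>;
  this is their number.
\<close>

definition num_frequencies :: "nat \<Rightarrow> nat" where
  "num_frequencies J = 2 ^ (J + 1) - 1"

lemma num_frequencies_Suc: "num_frequencies (Suc J) = num_frequencies J + 2 ^ J + 2 ^ J"
proof -
  have "(1::nat) \<le> 2 ^ J" by simp
  then show ?thesis by (simp add: num_frequencies_def)
qed

lemma of_nat_num_frequencies: "of_nat (num_frequencies J) = (2 ^ (J + 1) - 1 :: 'a::ring_1)"
  by (simp add: num_frequencies_def of_nat_diff)

lemma sum_centered_block_Suc:
  "(\<Sum>\<eta>\<in>block (1 - 2 ^ Suc J) (num_frequencies (Suc J)). g \<eta>) = (\<Sum>\<eta>\<in>block (1 - 2 ^ J) (num_frequencies J). g \<eta>) +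
    ((\<Sum>\<eta>\<in>block (2 ^ J) (2 ^ J). g \<eta>) + (\<Sum>\<eta>\<in>block (1 - 2 ^ (J + 1)) (2 ^ J). g \<eta>))"
proof -
  have c: "int (num_frequencies J) = 2 * 2 ^ J - 1"
    using of_nat_num_frequencies[of J, where 'a = int] by simp
  have cS: "int (num_frequencies (Suc J)) = 4 * 2 ^ J - 1"
    using of_nat_num_frequencies[of "Suc J", where 'a = int] by simp
  have pos: "(2::int) ^ J \<ge> 1" by simp
  have "block (1 - 2 ^ Suc J) (num_frequencies (Suc J)) =
      block (1 - 2 ^ J) (num_frequencies J) \<union> (block (2 ^ J) (2 ^ J) \<union> block (1 - 2 ^ (J + 1)) (2 ^ J))"
    using pos unfolding block_def c cS by auto
  moreover have "block (1 - 2 ^ J) (num_frequencies J) \<inter> (block (2 ^ J) (2 ^ J) \<union> block (1 - 2 ^ (J + 1)) (2 ^ J)) = {}"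
    using pos unfolding block_def c by auto
  moreover have "block (2 ^ J) (2 ^ J) \<inter> block (1 - 2 ^ (J + 1)) (2 ^ J) = {}"
    using pos unfolding block_def by auto
  moreover have "finite (block m M)" for m M
    by (simp add: block_def)
  ultimately show ?thesis
    by (simp add: sum.union_disjoint)
qed

lemma stage_kernel_atoms:
  "(\<lambda>N. \<Sum>i\<in>stage J N. wavelet i s * cnj (wavelet i t)) \<longlonglongrightarrow>
    (\<Sum>\<eta>\<in>block (1 - 2 ^ J) (num_frequencies J). atom \<eta> t s)"
proof (induction J)
  case 0
  show ?case
    using block_wavelet_kernel[of 1 0 s t]
    by (simp add: sum_stage_0 wavelet_eq_block_wavelet num_frequencies_def del: wavelet.simps)
next
  case (Suc J)
  show ?case
    unfolding sum_stage_Suc sum_centered_block_Suc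
    using block_wavelet_kernel[of "2 ^ J" "2 ^ J" s t] block_wavelet_kernel[of "2 ^ J" "1 - 2 ^ (J + 1)" s t]
    by (intro tendsto_add Suc) (simp_all add: wavelet_eq_block_wavelet del: wavelet.simps)
qed

text \<open>
  The union of the bands is symmetric about \<open>0\<close>, so the phase factor in \<open>sum_atom_block\<close> disappears.
\<close>

lemma stage_kernel:
  "(\<lambda>N. \<Sum>i\<in>stage J N. wavelet i s * cnj (wavelet i t)) \<longlonglongrightarrow>
    of_real (of_nat (num_frequencies J) * nsinc (of_nat (num_frequencies J) * (s - t)))"
proof -
  have "of_int (1 - 2 ^ J) + (of_nat (num_frequencies J) - 1) / 2 = (0::real)"
    by (simp add: of_nat_num_frequencies diff_divide_distrib)
  then show ?thesis
    using stage_kernel_atoms[where J = J and s = s and t = t] unfolding sum_atom_block by simp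
qed

lemma norm_stage_kernel_le:
  "norm (\<Sum>i\<in>stage J N. wavelet i s * cnj (wavelet i t)) \<le> of_nat (num_frequencies J)"
proof (induction J)
  case 0
  show ?case
    using norm_sum_block_wavelet_le[of 1 0 s t N]
    by (simp add: sum_stage_0 wavelet_eq_block_wavelet num_frequencies_def del: wavelet.simps)
next
  case (Suc J)
  have "norm (\<Sum>l\<in>{-int N..<int N}. wavelet (Plus J l) s * cnj (wavelet (Plus J l) t)) \<le> 2 ^ J"
    "norm (\<Sum>l\<in>{-int N..<int N}. wavelet (Minus J l) s * cnj (wavelet (Minus J l) t)) \<le> 2 ^ J"
    using norm_sum_block_wavelet_le[of "2 ^ J" "2 ^ J" s t N]
      norm_sum_block_wavelet_le[of "2 ^ J" "1 - 2 ^ (J + 1)" s t N]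
    by (simp_all add: wavelet_eq_block_wavelet del: wavelet.simps)
  then show ?case
    using Suc unfolding sum_stage_Suc num_frequencies_Suc
    by (intro order_trans[OF norm_triangle_ineq] order_trans[OF add_mono[OF order_refl norm_triangle_ineq]]) simp
qed

text \<open>
  The squared modulus of an integral is a double integral. The
  bound on the finite kernels allows the limit to be taken under both integrals.
\<close>

lemma (in finite_measure) sum_squared_integrals_limit:
  fixes e :: "'i \<Rightarrow> 'a \<Rightarrow> complex"
  assumes int: "\<And>i. integrable M (e i)"
    and bound: "\<And>N s t. norm (\<Sum>i\<in>F N. e i s * cnj (e i t)) \<le> C"
    and lim: "\<And>s t. (\<lambda>N. \<Sum>i\<in>F N. e i s * cnj (e i t)) \<longlonglongrightarrow> K s t"
  shows "(\<lambda>N. \<Sum>i\<in>F N. complex_of_real ((cmod (LINT x|M. e i x))\<^sup>2)) \<longlonglongrightarrow> (LINT s|M. LINT t|M. K s t)"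
proof -
  have meas [measurable]: "e i \<in> borel_measurable M" for i
    using int by (rule borel_measurable_integrable)
  define g where "g N s = (LINT t|M. (\<Sum>i\<in>F N. e i s * cnj (e i t)))" for N s
  have g: "g N s = (\<Sum>i\<in>F N. e i s * cnj (LINT t|M. e i t))" for N s
    unfolding g_def using int by simp
  have [measurable]: "g N \<in> borel_measurable M" for N
    unfolding g[abs_def] by measurable
  have sums: "(\<Sum>i\<in>F N. complex_of_real ((cmod (LINT x|M. e i x))\<^sup>2)) = (LINT s|M. g N s)" for N
    unfolding g complex_norm_square using int by simp
  have K: "K s \<in> borel_measurable M" for s
    by (rule borel_measurable_LIMSEQ_metric[OF _ lim]) measurable
  have g_lim: "(\<lambda>N. g N s) \<longlonglongrightarrow> (LINT t|M. K s t)" for s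
    unfolding g_def
  proof (rule integral_dominated_convergence[where w = "\<lambda>_. C"])
    show "AE t in M. norm (\<Sum>i\<in>F N. e i s * cnj (e i t)) \<le> C" for N
      by (rule AE_I2) (rule bound)
    show "AE t in M. (\<lambda>N. \<Sum>i\<in>F N. e i s * cnj (e i t)) \<longlonglongrightarrow> K s t"
      by (rule AE_I2) (rule lim)
  qed (use K in auto)
  have C: "0 \<le> C"
    by (rule order_trans[OF norm_ge_zero bound])
  have "norm (g N s) \<le> C * measure M (space M)" for N s
  proof -
    have "integrable M (\<lambda>t. \<Sum>i\<in>F N. e i s * cnj (e i t))"
      using int by simp
    then have "norm (g N s) \<le> (LINT t|M. C)"
      unfolding g_def by (intro order_trans[OF integral_norm_bound] integral_mono integrable_norm bound) simp_all
    then show ?thesis by (simp add: mult.commute)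
  qed
  moreover have [measurable]: "(\<lambda>s. LINT t|M. K s t) \<in> borel_measurable M"
    by (rule borel_measurable_LIMSEQ_metric[OF _ g_lim]) measurable
  ultimately have "(\<lambda>N. LINT s|M. g N s) \<longlonglongrightarrow> (LINT s|M. LINT t|M. K s t)"
    using g_lim by (intro integral_dominated_convergence[where w = "\<lambda>_. C * measure M (space M)"]) auto
  then show ?thesis
    unfolding sums .
qed

section \<open>Totality\<close>

lemma integral_nsinc_kernel:
  assumes "a \<le> b"
  shows "(LINT t|lborel. indicator {a..b} t *\<^sub>R (r * nsinc (r * (s - t)))) =
    (Si (pi * r * (s - a)) - Si (pi * r * (s - b))) / pi"
proof -
  have "(LINT t|lborel. indicator {a..b} t *\<^sub>R (r * nsinc (r * (s - t)))) =
      - (Si (pi * r * (s - b)) / pi) - - (Si (pi * r * (s - a)) / pi)"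
  proof (rule integral_FTC_atLeastAtMost[OF assms])
    fix t
    have "((\<lambda>t. - (Si (pi * r * (s - t)) / pi)) has_real_derivative
        - (sinc (pi * r * (s - t)) * (pi * r * (- 1)) / pi)) (at t within {a..b})"
      by (auto intro!: derivative_eq_intros DERIV_chain2[OF DERIV_Si] simp del: if_split_asm split del: if_split)
    moreover have "- (sinc (pi * r * (s - t)) * (pi * r * (- 1)) / pi) = r * nsinc (r * (s - t))"
    proof -
      have "- (S * (pi * r * (- 1)) / pi) = r * S" for S
        by simp
      then show ?thesis
        unfolding nsinc_def mult.assoc[of pi] .
    qed
    ultimately show "((\<lambda>t. - (Si (pi * r * (s - t)) / pi)) has_vector_derivative r * nsinc (r * (s - t))) (at t within {a..b})"
      unfolding has_real_derivative_iff_has_vector_derivative by (simp only:)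
  qed (intro continuous_intros)
  then show ?thesis
    by (simp add: diff_divide_distrib)
qed

text \<open>
  For \<open>a < s < b\<close> the inner integral tends to \<open>(pi / 2 + pi / 2) / pi = 1\<close> by Dirichlet's integral, and the
  sine integral is bounded.
\<close>

lemma double_integral_nsinc_limit:
  assumes "a \<le> b" and r: "filterlim r at_top sequentially" "\<And>n. r n \<ge> 0"
  shows "(\<lambda>n. LINT s|lborel. indicator {a..b} s *\<^sub>R (LINT t|lborel. indicator {a..b} t *\<^sub>R (r n * nsinc (r n * (s - t)))))
    \<longlonglongrightarrow> b - a"
proof -
  obtain B where B: "\<And>x. \<bar>Si x\<bar> \<le> B" using bounded_Si by blast
  have Si_lim: "(\<lambda>n. Si (pi * r n * x)) \<longlonglongrightarrow> pi / 2" if "x > 0" for x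
  proof -
    have "filterlim (\<lambda>n. (pi * x) * r n) at_top sequentially"
      using that by (intro filterlim_tendsto_pos_mult_at_top[OF tendsto_const _ r(1)]) simp
    from filterlim_compose[OF Si_at_top this] show ?thesis
      by (simp add: mult_ac)
  qed
  have "(\<lambda>n. LINT s|lborel. indicator {a..b} s *\<^sub>R ((Si (pi * r n * (s - a)) - Si (pi * r n * (s - b))) / pi))
      \<longlonglongrightarrow> (LINT s|lborel. indicator {a..b} s)"
  proof (rule integral_dominated_convergence[where w = "\<lambda>s. (2 * B / pi) * indicator {a..b} s"])
    show "integrable lborel (\<lambda>s. (2 * B / pi) * indicator {a..b} s)"
      using \<open>a \<le> b\<close> by (intro integrable_mult_right integrable_real_indicator) simp_all
    show "AE s in lborel. (\<lambda>n. indicator {a..b} s *\<^sub>R ((Si (pi * r n * (s - a)) - Si (pi * r n * (s - b))) / pi))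
        \<longlonglongrightarrow> indicator {a..b} s"
      using AE_lborel_singleton[of a] AE_lborel_singleton[of b]
    proof eventually_elim
      case (elim s)
      show ?case
      proof (cases "s \<in> {a..b}")
        case True
        then have s: "s - a > 0" "b - s > 0" using elim by auto
        have "Si (pi * r n * (s - b)) = - Si (pi * r n * (b - s))" for n
        proof -
          have "pi * r n * (b - s) \<ge> 0"
            using r(2)[of n] s by simp
          moreover have "pi * r n * (s - b) = - (pi * r n * (b - s))"
            by (simp add: algebra_simps)
          ultimately show ?thesis
            by (simp only: Si_neg)
        qed
        then have "(\<lambda>n. Si (pi * r n * (s - b))) \<longlonglongrightarrow> - (pi / 2)"
          using tendsto_minus[OF Si_lim[OF s(2)]] by simp
        then have "(\<lambda>n. (Si (pi * r n * (s - a)) - Si (pi * r n * (s - b))) / pi) \<longlonglongrightarrow> (pi / 2 - - (pi / 2)) / pi"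
          by (intro tendsto_divide tendsto_diff Si_lim s) auto
        then show ?thesis using True by simp
      qed simp
    qed
    fix n
    have "\<bar>Si x - Si y\<bar> / pi \<le> 2 * B / pi" for x y
      using B[of x] B[of y] by (intro divide_right_mono) auto
    then show "AE s in lborel. norm (indicator {a..b} s *\<^sub>R ((Si (pi * r n * (s - a)) - Si (pi * r n * (s - b))) / pi))
        \<le> (2 * B / pi) * indicator {a..b} s"
      by (intro AE_I2) (simp split: split_indicator)
  qed measurable
  then show ?thesis
    unfolding integral_nsinc_kernel[OF \<open>a \<le> b\<close>] using \<open>a \<le> b\<close> by simp
qed

lemma filterlim_num_frequencies: "filterlim (\<lambda>J. real (num_frequencies J)) at_top sequentially"
proof (rule filterlim_at_top_mono[OF filterlim_real_sequentially])
  show "\<forall>\<^sub>F J in sequentially. real J \<le> real (num_frequencies J)"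
  proof (rule always_eventually, rule allI)
    fix J
    have "J < 2 ^ J" by (rule less_exp)
    then show "real J \<le> real (num_frequencies J)"
      unfolding of_nat_le_iff num_frequencies_def power_add power_one_right by linarith
  qed
qed

text \<open>
  The limit in the translation parameter is taken first, at a fixed number of bands; it gives the double integral
  of the kernel. Then the number of bands grows.
\<close>

lemma wavelet_approximates_intervals:
  assumes "a \<le> b"
  shows "L2_approximable lborel wavelet (indicator {a..b})"
proof (rule L2_approximable_Bessel[OF wavelet_orthonormal])
  let ?f = "indicator {a..b} :: real \<Rightarrow> complex"
  let ?M = "restrict_space lborel {a..b}"
  have f_sq: "(cmod (?f x))\<^sup>2 = indicator {a..b} x" for x
    by (simp split: split_indicator)
  have ind: "integrable lborel (indicator {a..b} :: real \<Rightarrow> real)"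
    using assms by (intro integrable_real_indicator) simp_all
  show f: "?f \<in> L2_space lborel"
  proof -
    have "integrable lborel (\<lambda>x. (cmod (?f x))\<^sup>2)"
      unfolding f_sq by (rule ind)
    moreover have "?f \<in> borel_measurable lborel" by simp
    ultimately show ?thesis
      unfolding L2_space_def by blast
  qed
  have f_int: "(LINT x|lborel. (cmod (?f x))\<^sup>2) = b - a"
    unfolding f_sq using assms by simp
  interpret finite_measure ?M
    by (rule finite_measureI) (simp add: emeasure_restrict_space space_restrict_space assms)
  have wL: "wavelet i \<in> L2_space lborel" for i
    using wavelet_orthonormal by (simp add: L2_orthonormal_def)
  have int: "integrable ?M (wavelet i)" for i
  proof -
    have "integrable lborel (\<lambda>x. wavelet i x * cnj (?f x))"
      by (rule L2_product_integrable[OF wL f])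
    also have "(\<lambda>x. wavelet i x * cnj (?f x)) = (\<lambda>x. indicator {a..b} x *\<^sub>R wavelet i x)"
      by (rule ext) (simp split: split_indicator)
    finally show ?thesis
      by (simp add: integrable_restrict_space)
  qed
  have inner: "cmod (L2_inner lborel ?f (wavelet i)) = cmod (LINT x|?M. wavelet i x)" for i
  proof -
    have "L2_inner lborel ?f (wavelet i) = (LINT x|lborel. cnj (indicator {a..b} x *\<^sub>R wavelet i x))"
      unfolding L2_inner_def by (intro Bochner_Integration.integral_cong refl) (simp split: split_indicator)
    also have "\<dots> = cnj (LINT x|?M. wavelet i x)"
      by (simp add: integral_restrict_space del: complex_cnj_scaleR)
    finally show ?thesis by simp
  qed
  define I where "I J = (LINT s|lborel. indicator {a..b} s *\<^sub>R (LINT t|lborel. indicator {a..b} t *\<^sub>R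
    (of_nat (num_frequencies J) * nsinc (of_nat (num_frequencies J) * (s - t)))))" for J
  have lim: "(\<lambda>N. \<Sum>i\<in>stage J N. (cmod (L2_inner lborel ?f (wavelet i)))\<^sup>2) \<longlonglongrightarrow> I J" for J
  proof -
    have "(\<lambda>N. \<Sum>i\<in>stage J N. complex_of_real ((cmod (LINT x|?M. wavelet i x))\<^sup>2)) \<longlonglongrightarrow>
        (LINT s|?M. LINT t|?M. of_real (of_nat (num_frequencies J) * nsinc (of_nat (num_frequencies J) * (s - t))))"
      by (rule sum_squared_integrals_limit[OF int norm_stage_kernel_le stage_kernel])
    also have "(LINT s|?M. LINT t|?M. complex_of_real (of_nat (num_frequencies J) * nsinc (of_nat (num_frequencies J) * (s - t)))) =
        of_real (I J)"
    proof -
      have "(LINT x|?M. h x) = (LINT x|lborel. indicator {a..b} x *\<^sub>R h x)" for h :: "real \<Rightarrow> real"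
        by (simp add: integral_restrict_space)
      then show ?thesis
        unfolding integral_complex_of_real I_def by (simp only:)
    qed
    finally show ?thesis
      unfolding inner of_real_sum[symmetric] tendsto_of_real_iff .
  qed
  fix \<epsilon> :: real assume "\<epsilon> > 0"
  have "I \<longlonglongrightarrow> b - a"
    unfolding I_def[abs_def] by (intro double_integral_nsinc_limit assms filterlim_num_frequencies) simp
  then have "\<forall>\<^sub>F J in sequentially. b - a - \<epsilon> < I J"
    using \<open>\<epsilon> > 0\<close> by (intro order_tendstoD(1)) auto
  then obtain J where "b - a - \<epsilon> < I J"
    by (auto simp: eventually_sequentially)
  then have "\<forall>\<^sub>F N in sequentially. b - a - \<epsilon> < (\<Sum>i\<in>stage J N. (cmod (L2_inner lborel ?f (wavelet i)))\<^sup>2)"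
    by (rule order_tendstoD(1)[OF lim])
  then obtain N where "b - a - \<epsilon> < (\<Sum>i\<in>stage J N. (cmod (L2_inner lborel ?f (wavelet i)))\<^sup>2)"
    by (auto simp: eventually_sequentially)
  then show "\<exists>F. finite F \<and> (LINT x|lborel. (cmod (?f x))\<^sup>2) - \<epsilon> <
      (\<Sum>i\<in>F. (cmod (L2_inner lborel ?f (wavelet i)))\<^sup>2)"
    unfolding f_int using finite_stage by blast
qed

theorem mainTheorem4: "L2_orthonormal_basis lborel wavelet"
  unfolding L2_orthonormal_basis_def
proof
  show "L2_orthonormal lborel wavelet"
    by (rule wavelet_orthonormal)
  then show "L2_total lborel wavelet"
    by (intro L2_total_intervals wavelet_approximates_intervals) (simp add: L2_orthonormal_def)
qed

end
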